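(* Let $q=p^m\ge 5$ with $p$ prime such that $3\mid q-1$ and put $n=\frac{q-1}{3}$. Then the graph $\Gamma(3,q)$ is connected and undirected, with real spectrum given as follows. (a) If $p\equiv 1\pmod 3$ and $3\mid m$, then $$\mathrm{Spec}(\Gamma(3,q))=\Big\{[n]^1,\Big[\tfrac{a\sqrt[3]{q}-1}{3}\Big]^n,\Big[\tfrac{-\frac12(a+9b)\sqrt[3]{q}-1}{3}\Big]^n,\Big[\tfrac{-\frac12(a-9b)\sqrt[3]{q}-1}{3}\Big]^n\Big\},$$ where $a,b$ are the integers uniquely determined ($b$ up to sign) by $4\sqrt[3]{q}=a^2+27b^2$, $a\equiv 1\pmod 3$ and $(a,p)=1$. (b) If $p\equiv 1\pmod 3$ and $3\nmid m$, then $\mathrm{Spec}(\Gamma(3,q))=\{[n]^1,[x_0]^n,[x_1]^n,[x_2]^n\}$, where $$x_j=-\tfrac13\Big(1+\omega^jW+\frac{q}{\omega^jW}\Big),\qquad j\in\{0,1,2\},$$ $\omega=e^{2\pi i/3}$ and $W=\sqrt[3]{q}\,\sqrt[3]{\tfrac12(-a+\sqrt{-27}\,b)}$, with $a,b$ the integers uniquely determined ($b$ up to sign) by $4q=a^2+27b^2$, $a\equiv1\pmod 3$ and $(a,p)=1$. Here $\sqrt{\ }$ and $\sqrt[3]{\ }$ denote any square root and any cubic root, respectively. (c) If $p\equiv 2\pmod 3$ and $m$ is even, then $$\mathrm{Spec}(\Gamma(3,q))=\begin{cases}\big\{[n]^1,\big[\tfrac{\sqrt q-1}{3}\big]^{2n},\big[\tfrac{-2\sqrt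 q-1}{3}\big]^n\big\}& m\equiv 0\pmod 4,\\[2mm]\big\{[n]^1,\big[\tfrac{2\sqrt q-1}{3}\big]^{n},\big[\tfrac{-\sqrt q-1}{3}\big]^{2n}\big\}& m\equiv 2\pmod 4.\end{cases}$$ Furthermore, the spectrum is integral in cases (a) and (c).
   Context: For $k\mid q-1$, the generalized Paley graph $\Gamma(k,q)$ is the Cayley (di)graph with vertex set $\mathbb{F}_q$ and a directed edge from $u$ to $v$ iff $v-u\in R_k=\{x^k:x\in\mathbb{F}_q^*\}$; it is undirected if $R_k=-R_k$. $\mathrm{Spec}$ denotes the multiset of eigenvalues of the adjacency matrix, $[\lambda]^{r}$ meaning that $\lambda$ occurs with multiplicity $r$. $(a,p)$ denotes the greatest common divisor. *)

theory Defs
  imports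
    "HOL-Analysis.Analysis"
    "HOL-Number_Theory.Number_Theory"
    "Graph_Theory.Digraph_Component"
    "Graph_Theory.Pair_Digraph"
begin

definition power_residues :: "nat \<Rightarrow> 'a::field set" where
  "power_residues k = {x ^ k | x. x \<noteq> 0}"

definition gen_paley :: "nat \<Rightarrow> 'a::field pair_pre_digraph" where
  "gen_paley k = \<lparr> pverts = UNIV, parcs = {(u, v). v - u \<in> power_residues k} \<rparr>"

text \<open>
  Rows and columns are indexed by the whole vertex type, so the next three notions are meant for
  digraphs \<open>G\<close> with \<open>pverts G = UNIV\<close>.
\<close>

definition adjacency_matrix :: "'v::finite pair_pre_digraph \<Rightarrow> complex ^ 'v ^ 'v" where
  "adjacency_matrix G = (\<chi> u v. if (u, v) \<in> parcs G then 1 else 0)"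

definition characteristic_poly :: "'b::comm_ring_1 ^ 'v ^ 'v::finite \<Rightarrow> 'b poly" where
  "characteristic_poly A = det (\<chi> i j. (if i = j then [:0, 1:] else 0) - [:A $ i $ j:])"

text \<open>
  For a digraph the adjacency matrix need not be diagonalizable; multiplicities are the algebraic
  ones.
\<close>

definition graph_spectrum :: "'v::finite pair_pre_digraph \<Rightarrow> complex multiset" where
  "graph_spectrum G = proots (characteristic_poly (adjacency_matrix G))"

definition cubic_rep :: "nat \<Rightarrow> real \<Rightarrow> int \<Rightarrow> int \<Rightarrow> bool" where
  "cubic_rep p t a b \<longleftrightarrow>
     4 * t = of_int (a ^ 2 + 27 * b ^ 2) \<and> [a = 1] (mod 3) \<and> coprime a (int p)"

definition unique_up_to_sign :: "(int \<Rightarrow> int \<Rightarrow> bool) \<Rightarrow> bool" where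
  "unique_up_to_sign P \<longleftrightarrow>
     (\<exists>a b. \<forall>a' b'. P a' b' \<longleftrightarrow> a' = a \<and> (b' = b \<or> b' = - b))"

end

theory Submission
  imports Defs
begin

text \<open>
  Let \<open>F\<close> be the field with $q = 3n+1$ elements and \<open>R\<close> its group of nonzero cubes. A nontrivial additive character
  \<open>\<psi>\<close> of \<open>F\<close> exists (built from the trace), and the vectors $x \mapsto \psi(cx)$ diagonalise the adjacency matrix,
  with eigenvalues $\sum_{r \in R} \psi(cr)$ (\<open>graph_spectrum_gen_paley_character\<close>). These equal \<open>n\<close> for $c = 0$ and one
  of three Gauss periods $e_0, e_1, e_2$ on the three cosets of \<open>R\<close>, each of which has \<open>n\<close> elements. The periods
  are real because $-1$ is a cube.

  The periods are computed without multiplicative characters (\<open>period_polynomial\<close>). Orthogonality turns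
  the sums of $e_i$, $e_i^2$, $e_i^3$, $e_i^2 e_{i+1}$ and $e_i e_{i+1}^2$ into numbers of solutions of linear
  equations in cubes. With $y_i = 3e_i + 1$ this shows that the $y_i$ are the roots of $y^3 - 3qy - qA$ for an integer
  $A \equiv 1$ modulo 3, and that $\prod_{i<j}(y_i - y_j) = \pm 27qB$ for an integer \<open>B\<close>. Comparing with the
  discriminant gives $4q = A^2 + 27B^2$. Everything else is arithmetic of this equation.

  If $p \equiv 1$ modulo 3, then \<open>p\<close> does not divide \<open>A\<close>: counting solutions in \<open>F\<close> itself gives
  $A = -\binom{2n}{n}$ in \<open>F\<close> (\<open>of_int_A\<close>), which is nonzero by Lucas's theorem. Representations
  $4p^k = a^2 + 27b^2$ with $a \equiv 1$ modulo 3 coprime to \<open>p\<close> exist for $k \ge 1$ and are unique up to the sign of \<open>b\<close>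
  (\<open>cubic_rep_unique_up_to_sign\<close>): existence for $k = 1$ is Thue's lemma, and multiplication of norms does the
  rest. Hence \<open>A\<close> is the \<open>a\<close> belonging to $q$, and Cardano's formula gives the eigenvalues. If moreover
  $q = r^3$ with \<open>r\<close> a power of \<open>p\<close>, and $4r = a^2 + 27b^2$, then $A = a^3 - 3ar$ by uniqueness, and the cubic has the roots
  $ar$ and $-(a \pm 9b)r/2$.

  If $p \equiv 2$ modulo 3, then \<open>p\<close> is inert in the Eisenstein integers, and a descent gives $B = 0$ and
  $A = \pm 2\sqrt q$ with the sign fixed modulo 3; the cubic then has a double root.

  For connectedness, the set of vertices reachable from 0 is a union of $\{0\}$ and cosets of \<open>R\<close> and an
  additive subgroup, and counting disjoint translates shows that it is everything once $n \ge 2$.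
\<close>

section \<open>Representations of four times a prime power by the form of discriminant -108\<close>

lemma double_cong_1_mod_3_iff: "[2 * x = 1] (mod 3) \<longleftrightarrow> [- x = 1] (mod (3::int))"
proof -
  have "[2 * x = - x] (mod 3)" by (simp add: cong_iff_dvd_diff)
  thus ?thesis by (metis cong_sym cong_trans)
qed

lemma not_cong_1_mod_3_uminus:
  fixes x :: int
  assumes "[x = 1] (mod 3)" "[- x = 1] (mod 3)"
  shows False
  using cong_add[OF assms] by (simp add: cong_def)

lemma cubic_rep_int_iff:
  "cubic_rep p (real t) a b \<longleftrightarrow>
     4 * int t = a ^ 2 + 27 * b ^ 2 \<and> [a = 1] (mod 3) \<and> coprime a (int p)"
proof -
  have "4 * real t = real_of_int (a ^ 2 + 27 * b ^ 2) \<longleftrightarrow>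
        real_of_int (4 * int t) = real_of_int (a ^ 2 + 27 * b ^ 2)" by simp
  also have "\<dots> \<longleftrightarrow> 4 * int t = a ^ 2 + 27 * b ^ 2" by (rule of_int_eq_iff)
  finally show ?thesis by (simp add: cubic_rep_def)
qed

lemma prime_1_mod_3_ge_7:
  fixes p :: nat
  assumes "prime p" "[p = 1] (mod 3)"
  shows "p \<ge> 7"
proof (rule ccontr)
  assume "\<not> p \<ge> 7"
  hence "p \<in> {0,1,2,3,4,5,6}" by auto
  moreover have "\<not> prime (4::nat)" "\<not> prime (0::nat)" "\<not> prime (1::nat)"
    using prime_nat_iff'[of 4] by (auto intro!: bexI[of _ 2])
  ultimately show False using assms by (auto simp: cong_def)
qed

lemma parity_of_cubic_norm:
  fixes a b t :: int
  assumes "4 * t = a ^ 2 + 27 * b ^ 2"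
  shows "even (a - b)" "even (a + b)"
proof -
  have "even (a ^ 2 + 27 * b ^ 2)" using assms by (metis dvd_triv_left even_mult_iff even_numeral)
  thus "even (a - b)" "even (a + b)" by auto
qed

text \<open>
  Writing $4t = a^2 + 27b^2 = c^2 + 27d^2$ with $t = p^k$, the product
  $(ad - cb)(ad + cb) = 4t(d^2 - b^2)$ is divisible by $t$; coprimality to \<open>p\<close> puts all of \<open>t\<close> into
  one of the two factors, and that factor is then too large to be nonzero.
\<close>
lemma cubic_rep_unique:
  fixes p k :: nat
  assumes p: "prime p" "[p = 1] (mod 3)" and k: "k \<ge> 1"
    and ab: "cubic_rep p (real (p ^ k)) a b" and cd: "cubic_rep p (real (p ^ k)) c d"
  shows "c = a \<and> (d = b \<or> d = - b)"
proof -
  define t where "t = int (p ^ k)"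
  have p7: "p \<ge> 7" using prime_1_mod_3_ge_7 p by blast
  have tpos: "t > 0" using p7 by (simp add: t_def)
  have 1: "4 * t = a ^ 2 + 27 * b ^ 2" "[a = 1] (mod 3)" "coprime a (int p)"
    and 2: "4 * t = c ^ 2 + 27 * d ^ 2" "[c = 1] (mod 3)" "coprime c (int p)"
    using ab cd unfolding cubic_rep_int_iff t_def by auto
  have pp: "prime (int p)" using p by simp
  have na: "\<not> int p dvd a" and nc: "\<not> int p dvd c"
    using 1(3) 2(3) pp not_prime_unit coprime_common_divisor dvd_refl by blast+
  have pt: "int p dvd t" using k by (simp add: t_def)
  have nd: "\<not> int p dvd d"
  proof
    assume "int p dvd d"
    hence "int p dvd 4 * t - 27 * d ^ 2" using pt by (simp add: power2_eq_square)
    hence "int p dvd c ^ 2" using 2(1) by simp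
    thus False using nc pp prime_dvd_power by blast
  qed
  have prod: "(a * d - c * b) * (a * d + c * b) = 4 * t * (d ^ 2 - b ^ 2)"
  proof -
    have "(a * d - c * b) * (a * d + c * b) = a ^ 2 * d ^ 2 - c ^ 2 * b ^ 2"
      by (simp add: power2_eq_square algebra_simps)
    also have "\<dots> = (4 * t - 27 * b ^ 2) * d ^ 2 - (4 * t - 27 * d ^ 2) * b ^ 2"
      using 1(1) 2(1) by simp
    finally show ?thesis by (simp add: algebra_simps)
  qed
  have main: "d ^ 2 = b ^ 2" if td: "t dvd a * d - c * b'" and b': "b' ^ 2 = b ^ 2" and eb: "even (a - b')" for b'
  proof -
    have "even (a * d - c * b')"
      using parity_of_cubic_norm(1)[OF 2(1)] eb by (auto simp: even_diff_iff)
    moreover have "coprime 2 t"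
      using p7 p(1) unfolding t_def
      by (simp add: prime_odd_nat)
    ultimately have "2 * t dvd a * d - c * b'" using td by (simp add: divides_mult)
    then obtain z where z: "a * d - c * b' = 2 * t * z" by auto
    \<comment> \<open>Brahmagupta's identity: a nonzero multiple \<open>2 t z\<close> contributes at least \<open>108 t\<^sup>2\<close> to \<open>16 t\<^sup>2\<close>.\<close>
    have "(4 * t)\<^sup>2 = (a * c + 27 * b' * d) ^ 2 + 27 * (a * d - c * b') ^ 2"
    proof -
      have "(4 * t) ^ 2 = (a ^ 2 + 27 * b' ^ 2) * (c ^ 2 + 27 * d ^ 2)"
        unfolding b' 1(1)[symmetric] 2(1)[symmetric] by (simp add: power2_eq_square)
      thus ?thesis by (simp add: power2_eq_square algebra_simps)
    qed
    hence "(4 * t)\<^sup>2 = (a * c + 27 * b' * d) ^ 2 + 108 * t ^ 2 * z ^ 2"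
      unfolding z by (simp add: power_mult_distrib)
    moreover have "(4 * t) ^ 2 = 16 * t ^ 2" by (simp add: power_mult_distrib)
    ultimately have "108 * t ^ 2 * z ^ 2 \<le> 16 * t ^ 2"
      using zero_le_power2[of "a * c + 27 * b' * d"] by linarith
    hence le: "t ^ 2 * (108 * z ^ 2) \<le> t ^ 2 * 16" by (simp add: algebra_simps)
    have "108 * z ^ 2 \<le> 16" using le tpos by (simp add: mult_le_cancel_left)
    hence "z ^ 2 = 0" by (smt (verit) zero_le_power2)
    hence "a * d - c * b' = 0" using z by simp
    hence "(a * d) ^ 2 = (c * b) ^ 2" using b' by (simp add: power_mult_distrib)
    hence "(a * d - c * b) * (a * d + c * b) = 0" by (simp add: power2_eq_square algebra_simps)
    hence "4 * t * (d ^ 2 - b ^ 2) = 0" unfolding prod .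
    thus ?thesis using tpos by simp
  qed
  have "t dvd (a * d - c * b) * (a * d + c * b)" unfolding prod by simp
  have db: "d ^ 2 = b ^ 2"
  proof (cases "int p dvd a * d - c * b")
    case True
    have "\<not> int p dvd a * d + c * b"
    proof
      assume "int p dvd a * d + c * b"
      hence "int p dvd (a * d - c * b) + (a * d + c * b)" using True by (rule dvd_add[rotated])
      hence "int p dvd 2 * (a * d)" by (simp add: algebra_simps)
      moreover have "\<not> int p dvd 2" using p7 by (auto dest: zdvd_imp_le)
      ultimately show False using na nd pp by (metis prime_dvd_multD)
    qed
    hence "coprime (int p) (a * d + c * b)" using pp prime_imp_coprime by blast
    hence "coprime t (a * d + c * b)" unfolding t_def by simp
    hence "t dvd a * d - c * b"
      using \<open>t dvd (a * d - c * b) * (a * d + c * b)\<close> coprime_dvd_mult_left_iff by blast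
    thus ?thesis using main[of b] parity_of_cubic_norm(1)[OF 1(1)] by simp
  next
    case False
    hence "coprime (int p) (a * d - c * b)" using pp prime_imp_coprime by blast
    hence "coprime t (a * d - c * b)" unfolding t_def by simp
    hence "t dvd a * d + c * b"
      using \<open>t dvd (a * d - c * b) * (a * d + c * b)\<close> coprime_dvd_mult_right_iff by blast
    thus ?thesis using main[of "- b"] parity_of_cubic_norm(2)[OF 1(1)] by simp
  qed
  hence "c ^ 2 = a ^ 2" using 1(1) 2(1) by simp
  hence "c = a \<or> c = - a" by (simp add: power2_eq_iff)
  moreover have "c \<noteq> - a" using not_cong_1_mod_3_uminus[OF 1(2)] 2(2) by blast
  ultimately show ?thesis using db by (auto simp: power2_eq_iff)
qed

text \<open>
  Multiplication of $(a + 3b\sqrt{-3})/2$ by $(c + 3d\sqrt{-3})/2$ or by its conjugate. The two products have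
  traces $(ac \mp 27bd)/2$; since \<open>p\<close> does not divide their sum \<open>ac\<close>, one of the two choices keeps the
  trace coprime to \<open>p\<close>. The sign of the product is changed to restore the congruence modulo 3.
\<close>
lemma cubic_rep_mult:
  fixes p s t :: nat
  assumes p: "prime p" "p \<ge> 5" and dvd: "p dvd s" "p dvd t"
    and ab: "cubic_rep p (real s) a b" and cd: "cubic_rep p (real t) c d"
  shows "\<exists>e f. cubic_rep p (real (s * t)) e f"
proof -
  have 1: "4 * int s = a ^ 2 + 27 * b ^ 2" "[a = 1] (mod 3)" "coprime a (int p)"
    and 2: "4 * int t = c ^ 2 + 27 * d ^ 2" "[c = 1] (mod 3)" "coprime c (int p)"
    using ab cd unfolding cubic_rep_int_iff by auto
  have pp: "prime (int p)" using p by simp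
  have na: "\<not> int p dvd a" and nc: "\<not> int p dvd c"
    using 1(3) 2(3) pp not_prime_unit coprime_common_divisor dvd_refl by blast+
  have "\<exists>d'. (d' = d \<or> d' = - d) \<and> \<not> int p dvd a * c - 27 * b * d'"
  proof (rule ccontr)
    assume "\<not> ?thesis"
    hence "int p dvd a * c - 27 * b * d" "int p dvd a * c - 27 * b * (- d)" by blast+
    hence "int p dvd (a * c - 27 * b * d) + (a * c - 27 * b * (- d))" by (rule dvd_add)
    hence "int p dvd 2 * (a * c)" by (simp add: algebra_simps)
    moreover have "\<not> int p dvd 2" using p(2) by (auto dest: zdvd_imp_le)
    ultimately show False using na nc pp by (metis prime_dvd_multD)
  qed
  then obtain d' where d': "d' = d \<or> d' = - d" "\<not> int p dvd a * c - 27 * b * d'" by blast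
  have 3: "4 * int t = c ^ 2 + 27 * d' ^ 2" using 2(1) d'(1) by auto
  have "even (a * c - 27 * b * d')" "even (a * d' + c * b)"
    using parity_of_cubic_norm(1)[OF 1(1)] parity_of_cubic_norm(1)[OF 3] by auto
  then obtain e f where e: "a * c - 27 * b * d' = 2 * e" and f: "a * d' + c * b = 2 * f" by blast
  have "4 * (4 * (int s * int t)) = (4 * int s) * (4 * int t)" by simp
  also have "\<dots> = (a * c - 27 * b * d') ^ 2 + 27 * (a * d' + c * b) ^ 2"
    unfolding 1(1) 3 by (simp add: power2_eq_square algebra_simps)
  also have "\<dots> = 4 * ((- e) ^ 2 + 27 * f ^ 2)"
    unfolding e f by (simp add: power_mult_distrib)
  finally have "4 * int (s * t) = (- e) ^ 2 + 27 * f ^ 2" by simp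
  moreover have "[- e = 1] (mod 3)"
  proof -
    have "[a * c = 1 * 1] (mod 3)" using 1(2) 2(2) by (rule cong_mult)
    moreover have "a * c = 2 * e + 3 * (9 * b * d')" using e by simp
    ultimately have "[2 * e + 3 * (9 * b * d') = 1] (mod 3)" by simp
    hence "[2 * e = 1] (mod 3)" unfolding cong_def mod_mult_self2 .
    thus ?thesis by (simp only: double_cong_1_mod_3_iff)
  qed
  moreover have "coprime (- e) (int p)"
  proof -
    have "\<not> int p dvd e" using d'(2) e by auto
    hence "coprime (int p) e" using pp by (intro prime_imp_coprime)
    thus ?thesis by (simp add: coprime_commute)
  qed
  ultimately show ?thesis unfolding cubic_rep_int_iff by blast
qed

text \<open>
  Thue's lemma: by the pigeonhole principle the congruence $x \equiv ry$ modulo \<open>p\<close> has a nonzero solution with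
  both coordinates below $\sqrt p$.
\<close>
lemma thue_small_representatives:
  fixes p r :: int
  assumes p: "p > 1" "\<And>k::int. k ^ 2 \<noteq> p"
  obtains x y where "p dvd x - r * y" "x \<noteq> 0 \<or> y \<noteq> 0" "x ^ 2 < p" "y ^ 2 < p"
proof -
  define k where "k = nat (floor_sqrt (nat p))"
  have k2: "int k ^ 2 \<le> p" "p < (int k + 1) ^ 2"
  proof -
    have "k ^ 2 \<le> nat p" by (simp add: k_def)
    thus "int k ^ 2 \<le> p" using p by (metis of_nat_le_iff of_nat_power int_nat_eq less_trans zero_less_one less_imp_le)
    have "nat p < (Suc k) ^ 2" by (simp add: k_def Suc_floor_sqrt_power2_gt)
    hence "int (nat p) < int ((Suc k) ^ 2)" by (simp only: of_nat_less_iff)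
    thus "p < (int k + 1) ^ 2" using p by (simp add: add.commute)
  qed
  define S where "S = {0..int k} \<times> {0..int k}"
  define f where "f = (\<lambda>(x, y). (x - r * y) mod p)"
  have "f ` S \<subseteq> {0..<p}" using p by (auto simp: f_def S_def)
  hence "card (f ` S) \<le> nat p" using card_mono[of "{0..<p}" "f ` S"] by simp
  moreover have "card S = (k + 1) ^ 2" by (simp add: S_def card_cartesian_product power2_eq_square nat_add_distrib)
  moreover have "nat p < (k + 1) ^ 2" using k2 p by (smt (verit) nat_less_iff of_nat_1 of_nat_add of_nat_power)
  ultimately have "\<not> inj_on f S" by (intro pigeonhole) simp
  then obtain x y x' y' where xy: "(x, y) \<in> S" "(x', y') \<in> S" "(x, y) \<noteq> (x', y')" "f (x, y) = f (x', y')"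
    unfolding inj_on_def by auto
  have small: "(u - v) ^ 2 < p" if "0 \<le> u" "u \<le> int k" "0 \<le> v" "v \<le> int k" for u v :: int
  proof -
    have "\<bar>u - v\<bar> \<le> \<bar>int k\<bar>" using that by auto
    hence "(u - v) ^ 2 \<le> int k ^ 2" by (simp only: abs_le_square_iff)
    thus ?thesis using k2(1) p(2)[of "int k"] by linarith
  qed
  have "p dvd (x - r * y) - (x' - r * y')" using xy(4) by (simp add: f_def mod_eq_dvd_iff)
  hence "p dvd (x - x') - r * (y - y')" by (simp add: algebra_simps)
  thus ?thesis using that[of "x - x'" "y - y'"] xy small by (auto simp: S_def)
qed

text \<open>
  If \<open>z\<close> has order 3 modulo \<open>p\<close>, then $2z+1$ is a square root of $-3$.
\<close>
lemma prime_1_mod_3_sqrt_minus_3: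
  fixes p :: nat
  assumes "prime p" "[p = 1] (mod 3)"
  obtains r :: int where "int p dvd r ^ 2 + 3"
proof -
  have "3 dvd p - 1" using assms(2) prime_gt_1_nat[OF assms(1)]
    by (metis cong_altdef_nat cong_sym less_imp_le)
  then obtain k where k: "p - 1 = 3 * k" by auto
  have k0: "0 < k" using k prime_gt_1_nat[OF assms(1)] by auto
  obtain g where g: "residue_primroot p g"
    using prime_primitive_root_exists[of p] prime_gt_1_nat[OF assms(1)] assms(1) by auto
  have ord: "ord p g = p - 1" using g assms(1) by (simp add: residue_primroot_def totient_prime)
  define z where "z = int (g ^ k)"
  have "[g ^ (p - 1) = 1] (mod p)" using ord by (metis ord_divides dvd_refl)
  hence "[z ^ 3 = 1] (mod int p)" unfolding z_def k
    by (metis cong_int_iff mult.commute of_nat_1 of_nat_power power_mult)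
  hence "int p dvd (z - 1) * (z ^ 2 + z + 1)"
    by (simp add: cong_iff_dvd_diff power2_eq_square power3_eq_cube algebra_simps)
  moreover have "\<not> int p dvd z - 1"
  proof
    assume "int p dvd z - 1"
    hence "[z = 1] (mod int p)" by (simp add: cong_iff_dvd_diff)
    hence "[g ^ k = 1] (mod p)" unfolding z_def by (metis cong_int_iff of_nat_1)
    hence "p - 1 dvd k" using ord ord_divides by metis
    thus False using k k0 by (auto dest: dvd_imp_le)
  qed
  ultimately have "int p dvd z ^ 2 + z + 1"
    using assms(1) prime_dvd_mult_iff[of "int p"] by auto
  hence "int p dvd 4 * (z ^ 2 + z + 1)" by (rule dvd_mult)
  hence "int p dvd (2 * z + 1) ^ 2 + 3" by (simp add: power2_eq_square algebra_simps)
  thus ?thesis using that by blast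
qed

lemma prime_1_mod_3_eq_square_plus_3_square:
  fixes p :: nat
  assumes "prime p" "[p = 1] (mod 3)"
  obtains x y :: int where "int p = x ^ 2 + 3 * y ^ 2"
proof -
  define P where "P = int p"
  have pp: "prime P" using assms by (simp add: P_def)
  have P7: "P \<ge> 7" using prime_1_mod_3_ge_7[OF assms] by (simp add: P_def)
  obtain r where r: "P dvd r ^ 2 + 3" using prime_1_mod_3_sqrt_minus_3[OF assms] by (auto simp: P_def)
  have ns: "k ^ 2 \<noteq> P" for k :: int
    using pp by (auto simp: prime_power_iff)
  obtain x y where xy: "P dvd x - r * y" "x \<noteq> 0 \<or> y \<noteq> 0" "x ^ 2 < P" "y ^ 2 < P"
    using thue_small_representatives[of P r] P7 ns by auto
  have "P dvd (x - r * y) * (x + r * y) + (r ^ 2 + 3) * y ^ 2" using xy(1) r by simp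
  also have "(x - r * y) * (x + r * y) + (r ^ 2 + 3) * y ^ 2 = x ^ 2 + 3 * y ^ 2"
    by (simp add: power2_eq_square algebra_simps)
  finally obtain j where j: "x ^ 2 + 3 * y ^ 2 = P * j" by auto
  have "x ^ 2 + 3 * y ^ 2 > 0" using xy(2)
    by (smt (verit) zero_less_power2 zero_le_power2)
  hence "P * 0 < P * j" unfolding j by simp
  moreover have "P * j < P * 4" using xy(3,4) j by linarith
  ultimately have "0 < j" "j < 4" using P7 by (simp_all add: zero_less_mult_iff)
  \<comment> \<open>The case \<open>j = 2\<close> is impossible modulo 4, and \<open>j = 3\<close> reduces to \<open>j = 1\<close>.\<close>
  hence "j = 1 \<or> j = 2 \<or> j = 3" by auto
  thus ?thesis
  proof (elim disjE)
    assume "j = 1"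
    thus ?thesis using that[of x y] j by (simp add: P_def)
  next
    assume "j = 2"
    have "odd P" using P7 pp by (simp add: prime_odd_int)
    have "even (x ^ 2 + 3 * y ^ 2)" using j \<open>j = 2\<close> by simp
    hence e: "even (x - y)" by auto
    then obtain u where "x - y = 2 * u" by blast
    hence u: "x = y + 2 * u" by simp
    have "2 * P = 4 * (u ^ 2 + u * y + y ^ 2)"
      using j \<open>j = 2\<close> unfolding u by (simp add: power2_eq_square algebra_simps)
    hence "P = 2 * (u ^ 2 + u * y + y ^ 2)" by simp
    thus ?thesis using \<open>odd P\<close> by simp
  next
    assume "j = 3"
    have "x ^ 2 = 3 * (P - y ^ 2)" using j \<open>j = 3\<close> by simp
    hence "3 dvd x ^ 2" by simp
    hence "3 dvd x" using prime_dvd_power[of "3::int" x 2] by simp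
    then obtain u where u: "x = 3 * u" by blast
    have "P = y ^ 2 + 3 * u ^ 2" using j \<open>j = 3\<close> unfolding u by (simp add: power2_eq_square)
    thus ?thesis using that[of y u] by (simp add: P_def)
  qed
qed

text \<open>
  From $p = x^2 + 3y^2$ one gets $4p$ as $(2x)^2 + 3(2y)^2$ or $(x \pm 3y)^2 + 3(x \mp y)^2$, and 3 divides one of
  $y$, $x - y$, $x + y$ because it does not divide \<open>x\<close>.
\<close>
lemma cubic_rep_prime_exists:
  fixes p :: nat
  assumes "prime p" "[p = 1] (mod 3)"
  shows "\<exists>a b. cubic_rep p (real p) a b"
proof -
  define P where "P = int p"
  have pp: "prime P" using assms by (simp add: P_def)
  have P7: "P \<ge> 7" using prime_1_mod_3_ge_7[OF assms] by (simp add: P_def)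
  have P3: "P mod 3 = 1" using assms(2) unfolding cong_def P_def by presburger
  obtain x y where xy: "P = x ^ 2 + 3 * y ^ 2"
    using prime_1_mod_3_eq_square_plus_3_square[OF assms] by (auto simp: P_def)
  have nx: "\<not> 3 dvd x"
  proof
    assume "3 dvd x"
    hence "3 dvd P" unfolding xy by (simp add: power2_eq_square)
    thus False using P3 by presburger
  qed
  have "\<exists>a b. 4 * P = a ^ 2 + 27 * b ^ 2"
  proof -
    have "3 dvd y \<or> 3 dvd x - y \<or> 3 dvd x + y" using nx by presburger
    then consider "3 dvd y" | "3 dvd x - y" | "3 dvd x + y" by blast
    thus ?thesis
    proof cases
      case 1
      then obtain z where "y = 3 * z" by blast
      hence "4 * P = (2 * x) ^ 2 + 27 * (2 * z) ^ 2" unfolding xy by (simp add: power2_eq_square)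
      thus ?thesis by blast
    next
      case 2
      then obtain z where z: "x - y = 3 * z" by blast
      have "4 * P = (x + 3 * y) ^ 2 + 3 * (x - y) ^ 2" unfolding xy by (simp add: power2_eq_square algebra_simps)
      hence "4 * P = (x + 3 * y) ^ 2 + 27 * z ^ 2" unfolding z by (simp add: power2_eq_square)
      thus ?thesis by blast
    next
      case 3
      then obtain z where z: "x + y = 3 * z" by blast
      have "4 * P = (x - 3 * y) ^ 2 + 3 * (x + y) ^ 2" unfolding xy by (simp add: power2_eq_square algebra_simps)
      hence "4 * P = (x - 3 * y) ^ 2 + 27 * z ^ 2" unfolding z by (simp add: power2_eq_square)
      thus ?thesis by blast
    qed
  qed
  then obtain a b where ab: "4 * P = a ^ 2 + 27 * b ^ 2" by blast
  have "\<not> 3 dvd a"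
  proof
    assume "3 dvd a"
    hence "3 dvd a ^ 2 + 27 * b ^ 2" by (simp add: power2_eq_square)
    hence "3 dvd 4 * P" unfolding ab .
    thus False using P3 by presburger
  qed
  hence "a mod 3 = 1 \<or> (- a) mod 3 = 1" by presburger
  then obtain a' where a': "a' = a \<or> a' = - a" "a' mod 3 = 1" by blast
  have ab': "4 * P = a' ^ 2 + 27 * b ^ 2" using ab a'(1) by auto
  have "\<not> P dvd a'"
  proof
    assume "P dvd a'"
    then obtain z where z: "a' = P * z" by blast
    have "z \<noteq> 0" using a'(2) z by auto
    hence "1 \<le> z ^ 2" by (smt (verit) zero_less_power2)
    hence "P * P * 1 \<le> P * P * z ^ 2" by (intro mult_left_mono) auto
    also have "\<dots> \<le> 4 * P" unfolding ab' z by (simp add: power2_eq_square)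
    finally have "P * P \<le> P * 4" by simp
    thus False using P7 by (simp add: mult_le_cancel_left)
  qed
  hence "coprime a' P" using pp by (metis coprime_commute prime_imp_coprime)
  thus ?thesis using ab' a'(2) unfolding cubic_rep_int_iff by (auto simp: P_def cong_def)
qed

lemma cubic_rep_prime_power_exists:
  fixes p k :: nat
  assumes "prime p" "[p = 1] (mod 3)" "k \<ge> 1"
  shows "\<exists>a b. cubic_rep p (real (p ^ k)) a b"
  using assms(3)
proof (induction k rule: dec_induct)
  case base
  thus ?case using cubic_rep_prime_exists[OF assms(1,2)] by simp
next
  case (step k)
  obtain a b where ab: "cubic_rep p (real (p ^ k)) a b" using step.IH by blast
  obtain c d where cd: "cubic_rep p (real p) c d" using cubic_rep_prime_exists[OF assms(1,2)] by blast
  have "p dvd p ^ k" using step.hyps by simp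
  hence "\<exists>e f. cubic_rep p (real (p ^ k * p)) e f"
    using cubic_rep_mult[OF assms(1) _ _ _ ab cd] prime_1_mod_3_ge_7[OF assms(1,2)] by simp
  thus ?case by (simp add: mult.commute)
qed

lemma cubic_rep_unique_up_to_sign:
  fixes p k :: nat
  assumes "prime p" "[p = 1] (mod 3)" "k \<ge> 1"
  shows "unique_up_to_sign (cubic_rep p (real (p ^ k)))"
proof -
  obtain a b where ab: "cubic_rep p (real (p ^ k)) a b"
    using cubic_rep_prime_power_exists[OF assms] by blast
  have "cubic_rep p (real (p ^ k)) a (- b)" using ab by (simp add: cubic_rep_def)
  with ab show ?thesis unfolding unique_up_to_sign_def
    using cubic_rep_unique[OF assms ab] by blast
qed

text \<open>
  A prime $p \equiv 2$ modulo 3 is inert in the Eisenstein integers: $u^2 + uv + v^2 \equiv 0$ gives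
  $u^3 \equiv v^3$, and cubing is injective modulo such \<open>p\<close>, so $u \equiv v$ and $3v^2 \equiv 0$.
\<close>
lemma eisenstein_norm_inert:
  fixes p :: nat and u v :: int
  assumes p: "prime p" "[p = 2] (mod 3)" and d: "int p dvd u ^ 2 + u * v + v ^ 2"
  shows "int p dvd u \<and> int p dvd v"
proof -
  have pp: "prime (int p)" using p by simp
  have "p mod 3 = 2" using p(2) by (simp add: cong_def)
  hence "p = 3 * (p div 3) + 2" by presburger
  then obtain k where k: "p = 3 * k + 2" by blast
  have *: "int p dvd v" if d: "int p dvd u ^ 2 + u * v + v ^ 2" for u v :: int
  proof (rule ccontr)
    assume nv: "\<not> int p dvd v"
    have nu: "\<not> int p dvd u"
    proof
      assume "int p dvd u"
      hence "int p dvd u * (u + v)" by simp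
      with d have "int p dvd (u ^ 2 + u * v + v ^ 2) - u * (u + v)" by (rule dvd_diff)
      also have "(u ^ 2 + u * v + v ^ 2) - u * (u + v) = v ^ 2"
        by (simp add: power2_eq_square algebra_simps)
      finally show False using nv pp prime_dvd_power by blast
    qed
    have "int p dvd (u - v) * (u ^ 2 + u * v + v ^ 2)" using d by simp
    hence c3: "[u ^ 3 = v ^ 3] (mod int p)"
      by (simp add: cong_iff_dvd_diff power2_eq_square power3_eq_cube algebra_simps)
    have fermat: "[w ^ (p - 1) = 1] (mod int p)" if "\<not> int p dvd w" for w :: int
    proof -
      define w' where "w' = nat (w mod int p)"
      have w': "int w' = w mod int p" using prime_gt_0_nat[OF p(1)] by (simp add: w'_def)
      have "\<not> p dvd w'" using that w' by (metis dvd_mod_iff int_dvd_int_iff dvd_refl)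
      hence "[w' ^ (p - 1) = 1] (mod p)" using p(1) by (rule fermat_theorem[rotated])
      hence "[int w' ^ (p - 1) = 1] (mod int p)" by (metis cong_int_iff of_nat_1 of_nat_power)
      thus ?thesis unfolding w' by (simp add: cong_def power_mod)
    qed
    have "[u ^ (p - 1) = v ^ (p - 1)] (mod int p)" using fermat nu nv cong_trans cong_sym by blast
    moreover have "w ^ (p - 1) = (w ^ 3) ^ k * w" for w :: int
    proof -
      have "p - 1 = Suc (3 * k)" using k by simp
      hence "w ^ (p - 1) = w ^ (3 * k) * w" by simp
      thus ?thesis by (simp only: power_mult)
    qed
    ultimately have "[(u ^ 3) ^ k * u = (v ^ 3) ^ k * v] (mod int p)"
      by simp
    moreover have "[(u ^ 3) ^ k * u = (v ^ 3) ^ k * u] (mod int p)"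
      by (rule cong_scalar_right[OF cong_pow[OF c3]])
    ultimately have "[(v ^ 3) ^ k * u = (v ^ 3) ^ k * v] (mod int p)" using cong_trans cong_sym by blast
    hence "int p dvd (v ^ 3) ^ k * (u - v)" by (simp add: cong_iff_dvd_diff algebra_simps)
    hence uv: "int p dvd u - v" using nv pp by (metis prime_dvd_mult_iff prime_dvd_power)
    have "int p dvd (u ^ 2 + u * v + v ^ 2) - (u - v) * (u + 2 * v)"
      using uv d by (intro dvd_diff) auto
    hence "int p dvd 3 * v ^ 2" by (simp add: power2_eq_square algebra_simps)
    moreover have "\<not> int p dvd 3"
    proof
      assume "int p dvd 3"
      hence "p dvd 3" by (metis int_dvd_int_iff of_nat_numeral)
      hence "p = 3" using p(1) by (intro primes_dvd_imp_eq) auto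
      thus False using k by presburger
    qed
    ultimately show False using nv pp by (metis prime_dvd_mult_iff prime_dvd_power)
  qed
  have "int p dvd v ^ 2 + v * u + u ^ 2" using d by (simp add: algebra_simps)
  thus ?thesis using *[of v u] *[of u v] d by blast
qed

text \<open>
  Descent on \<open>k\<close>, in the coordinates $u = (a - 3b)/2$ and $v = 3b$, for which
  $u^2 + uv + v^2 = (a^2 + 27b^2)/4$.
\<close>
lemma cubic_norm_inert_power:
  fixes p k :: nat and a b :: int
  assumes p: "prime p" "[p = 2] (mod 3)" and ab: "4 * int (p ^ (2 * k)) = a ^ 2 + 27 * b ^ 2"
  shows "b = 0"
  using ab
proof (induction k arbitrary: a b)
  case 0
  hence *: "a ^ 2 + 27 * b ^ 2 = 4" by simp
  have "b ^ 2 = 0"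
    using * zero_le_power2[of a] zero_le_power2[of b] by linarith
  thus ?case by simp
next
  case (Suc k)
  define P where "P = int p"
  have P: "P > 0" using p prime_gt_0_nat by (simp add: P_def)
  obtain u where u: "a = 2 * u + 3 * b"
  proof -
    have "even (a - b)" using Suc.prems by (rule parity_of_cubic_norm)
    hence "even (a - 3 * b)" by simp
    then obtain u where "a - 3 * b = 2 * u" by blast
    thus ?thesis using that[of u] by simp
  qed
  have eq: "P ^ 2 * P ^ (2 * k) = u ^ 2 + u * (3 * b) + (3 * b) ^ 2"
  proof -
    have "4 * (P ^ 2 * P ^ (2 * k)) = 4 * (u ^ 2 + u * (3 * b) + (3 * b) ^ 2)"
      using Suc.prems unfolding u P_def by (simp add: power2_eq_square algebra_simps)
    thus ?thesis by simp
  qed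
  have "P dvd P ^ 2 * P ^ (2 * k)" by (simp add: power2_eq_square)
  hence "P dvd u \<and> P dvd 3 * b"
    unfolding eq unfolding P_def by (rule eisenstein_norm_inert[OF p])
  moreover have "coprime P 3"
  proof -
    have "\<not> 3 dvd p" using p(2) by (auto simp: cong_def)
    hence "coprime 3 p" by (intro prime_imp_coprime) auto
    hence "coprime (int 3) (int p)" by (simp only: coprime_int_iff)
    thus ?thesis by (simp add: P_def coprime_commute)
  qed
  ultimately have "P dvd u" "P dvd b" by (simp_all add: coprime_dvd_mult_right_iff)
  then obtain u' b' where ub: "u = P * u'" "b = P * b'" by blast
  have "P ^ 2 * P ^ (2 * k) = P ^ 2 * (u' ^ 2 + u' * (3 * b') + (3 * b') ^ 2)"
    unfolding eq ub by (simp add: power2_eq_square algebra_simps)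
  hence "P ^ (2 * k) = u' ^ 2 + u' * (3 * b') + (3 * b') ^ 2" using P by simp
  hence "4 * P ^ (2 * k) = (2 * u' + 3 * b') ^ 2 + 27 * b' ^ 2"
    by (simp add: power2_eq_square algebra_simps)
  hence "b' = 0" using Suc.IH by (simp add: P_def)
  thus ?case by (simp add: ub)
qed

section \<open>Characteristic polynomials and character eigenvalues\<close>

lemma poly_det:
  fixes M :: "'b::comm_ring_1 poly ^ 'v ^ 'v::finite"
  shows "poly (det M) x = det (\<chi> i j. poly (M $ i $ j) x)"
  by (simp add: det_def poly_sum poly_prod of_int_poly)

lemma characteristic_poly_diagonalizable:
  fixes A P :: "'b::idom ^ 'v ^ 'v::finite" and d :: "'v \<Rightarrow> 'b"
  assumes det: "det P \<noteq> 0" and AP: "A ** P = (\<chi> i j. P $ i $ j * d j)"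
  shows "characteristic_poly A = (\<Prod>i\<in>UNIV. [:- d i, 1:])"
proof -
  define X :: "'b poly ^ 'v ^ 'v"
    where "X = (\<chi> i j. (if i = j then [:0, 1:] else 0) - [:A $ i $ j:])"
  define M :: "'b poly ^ 'v ^ 'v" where "M = (\<chi> i j. [:P $ i $ j:])"
  define D :: "'b poly ^ 'v ^ 'v" where "D = (\<chi> i j. if i = j then [:- d i, 1:] else 0)"
  \<comment> \<open>\<open>M\<close> consists of constant polynomials, so its determinant can be tested at 0.\<close>
  have "poly (det M) 0 = det P" by (simp add: poly_det M_def)
  hence M0: "det M \<noteq> 0" using det by auto
  have "X ** M = M ** D"
  proof (subst vec_eq_iff, subst vec_eq_iff, intro allI)
    fix i j
    have AP': "(\<Sum>k\<in>UNIV. A $ i $ k * P $ k $ j) = P $ i $ j * d j"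
      using arg_cong[OF AP, of "\<lambda>M. M $ i $ j"] by (simp add: matrix_matrix_mult_def)
    have "(X ** M) $ i $ j
        = (\<Sum>k\<in>UNIV. (if i = k then [:0, 1:] * [:P $ k $ j:] else 0) - [:A $ i $ k * P $ k $ j:])"
      unfolding matrix_matrix_mult_def X_def M_def
      by (simp, intro sum.cong) (auto simp: algebra_simps)
    also have "\<dots> = [:0, 1:] * [:P $ i $ j:] - (\<Sum>k\<in>UNIV. [:A $ i $ k * P $ k $ j:])"
      by (simp add: sum_subtractf)
    also have "(\<Sum>k\<in>UNIV. [:A $ i $ k * P $ k $ j:]) = [:P $ i $ j * d j:]"
      unfolding AP'[symmetric] by (induction rule: infinite_finite_induct) auto
    also have "[:0, 1:] * [:P $ i $ j:] - [:P $ i $ j * d j:] = [:P $ i $ j:] * [:- d j, 1:]"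
      by simp
    also have "\<dots> = (M ** D) $ i $ j"
      unfolding matrix_matrix_mult_def M_def D_def
      by (simp add: if_distrib cong: if_cong)
    finally show "(X ** M) $ i $ j = (M ** D) $ i $ j" .
  qed
  hence "det X * det M = det M * det D" by (metis det_mul)
  hence "det X = det D" using M0 by (simp add: mult.commute)
  also have "det D = (\<Prod>i\<in>UNIV. D $ i $ i)" by (rule det_diagonal) (simp add: D_def)
  finally show ?thesis by (simp add: characteristic_poly_def X_def D_def)
qed

lemma proots_prod_linear:
  "proots (\<Prod>i\<in>I. [:- d i :: 'b::idom, 1:]) = (\<Sum>i\<in>I. {#d i#})"
  by (subst proots_prod) auto

lemma adjacency_gen_paley_nth:
  "adjacency_matrix (gen_paley k) $ u $ v = (if v - u \<in> power_residues k then 1 else 0)"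
  by (simp add: adjacency_matrix_def gen_paley_def)

text \<open>
  The matrix with entries $\psi(cx)$ diagonalises the adjacency matrix; orthogonality makes it invertible.
  The eigenvalue belonging to \<open>c\<close> is the sum of $\psi(cr)$ over the connection set.
\<close>
lemma graph_spectrum_gen_paley_character:
  fixes \<psi> :: "'a::{field,finite} \<Rightarrow> complex"
  assumes add: "\<And>x y. \<psi> (x + y) = \<psi> x * \<psi> y"
    and orth: "\<And>x. (\<Sum>c\<in>UNIV. \<psi> (c * x)) = (if x = 0 then of_nat CARD('a) else 0)"
  shows "graph_spectrum (gen_paley k :: 'a pair_pre_digraph) =
    (\<Sum>c\<in>UNIV. {#\<Sum>r\<in>power_residues k. \<psi> (c * r)#})"
proof -
  define ev where "ev = (\<lambda>c. \<Sum>r\<in>power_residues k. \<psi> (c * r))"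
  define A :: "((complex, 'a) vec, 'a) vec" where "A = adjacency_matrix (gen_paley k)"
  define P :: "((complex, 'a) vec, 'a) vec" where "P = (\<chi> x c. \<psi> (c * x))"
  define Q :: "((complex, 'a) vec, 'a) vec" where "Q = (\<chi> c x. \<psi> (- (c * x)))"
  have PQ: "P ** Q = (\<chi> x y. if x = y then of_nat CARD('a) else 0)"
  proof (subst vec_eq_iff, subst vec_eq_iff, intro allI)
    fix x y
    have "(P ** Q) $ x $ y = (\<Sum>c\<in>UNIV. \<psi> (c * (x - y)))"
      by (simp add: P_def Q_def matrix_matrix_mult_def algebra_simps flip: add)
    thus "(P ** Q) $ x $ y = (\<chi> x y. if x = y then of_nat CARD('a) else 0) $ x $ y"
      by (simp add: orth)
  qed
  have "det P * det Q = (\<Prod>x::'a\<in>UNIV. of_nat CARD('a))"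
    unfolding det_mul[symmetric] PQ by (subst det_diagonal) auto
  hence P0: "det P \<noteq> 0" by auto
  have "A ** P = (\<chi> x c. P $ x $ c * ev c)"
  proof (subst vec_eq_iff, subst vec_eq_iff, intro allI)
    fix x c
    have "(A ** P) $ x $ c = (\<Sum>v\<in>UNIV. if v - x \<in> power_residues k then \<psi> (c * v) else 0)"
      unfolding matrix_matrix_mult_def A_def P_def
      by (simp add: adjacency_gen_paley_nth if_distrib if_distribR cong: if_cong)
    also have "\<dots> = (\<Sum>v | v - x \<in> power_residues k. \<psi> (c * v))"
      by (simp add: sum.If_cases)
    also have "\<dots> = (\<Sum>r\<in>power_residues k. \<psi> (c * (x + r)))"
      by (rule sum.reindex_bij_witness[of _ "\<lambda>r. x + r" "\<lambda>v. v - x"]) auto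
    also have "\<dots> = P $ x $ c * ev c"
      by (simp add: P_def ev_def distrib_left add sum_distrib_left)
    finally show "(A ** P) $ x $ c = (\<chi> x c. P $ x $ c * ev c) $ x $ c" by simp
  qed
  hence "characteristic_poly A = (\<Prod>c\<in>UNIV. [:- ev c, 1:])"
    by (rule characteristic_poly_diagonalizable[OF P0])
  thus ?thesis unfolding graph_spectrum_def A_def[symmetric] ev_def by (simp add: proots_prod_linear)
qed

lemma proots_cubic:
  fixes a b c :: "'b::idom"
  shows "proots ([:- a, 1:] * [:- b, 1:] * [:- c, 1:]) = {#a, b, c#}"
  by (simp add: proots_mult del: mult_pCons_left mult_pCons_right)

lemma mset3_eqI:
  fixes a b c x y z :: "'b::idom"
  assumes "a + b + c = x + y + z" "a * b + b * c + c * a = x * y + y * z + z * x" "a * b * c = x * y * z"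
  shows "{#a, b, c#} = {#x, y, z#}"
proof -
  have *: "[:- a, 1:] * [:- b, 1:] * [:- c, 1:] = [:- (a * b * c), a * b + b * c + c * a, - (a + b + c), 1:]"
    for a b c :: 'b by (simp add: algebra_simps)
  have "[:- a, 1:] * [:- b, 1:] * [:- c, 1:] = [:- x, 1:] * [:- y, 1:] * [:- z, 1:]"
    unfolding * assms ..
  thus ?thesis by (metis proots_cubic)
qed

section \<open>Finite fields: power residues and power sums\<close>

lemma card_nth_roots_le:
  fixes y :: "'a::idom"
  assumes "k > 0"
  shows "card {x. x ^ k = y} \<le> k"
proof -
  define f where "f = Polynomial.monom (1::'a) k - [:y:]"
  have "Polynomial.coeff f k = 1" using assms by (simp add: f_def coeff_pCons split: nat.splits)
  hence "f \<noteq> 0" by auto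
  hence "card {x. poly f x = 0} \<le> Polynomial.degree f" by (rule card_poly_roots_bound)
  also have "Polynomial.degree f \<le> k" unfolding f_def by (intro degree_diff_le) (auto simp: degree_monom_le)
  also have "{x. poly f x = 0} = {x. x ^ k = y}" by (simp add: f_def poly_monom)
  finally show ?thesis .
qed

lemma power_card_minus_1_eq_1:
  fixes x :: "'a::{field,finite}"
  assumes "x \<noteq> 0"
  shows "x ^ (CARD('a) - 1) = 1"
proof -
  have "(\<Prod>y\<in>UNIV-{0}. x * y) = (\<Prod>y\<in>UNIV-{0}. y)"
    by (rule prod.reindex_bij_witness[of _ "\<lambda>y. y / x" "\<lambda>y. x * y"]) (use assms in auto)
  hence "x ^ (CARD('a) - 1) * (\<Prod>y\<in>UNIV-{0}. y) = (\<Prod>y\<in>UNIV-{0}. y)"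
    by (simp add: prod.distrib card_Diff_singleton)
  moreover have "(\<Prod>y\<in>UNIV-{0}. y :: 'a) \<noteq> 0" by simp
  ultimately show ?thesis by simp
qed

lemma power_card_eq_same:
  fixes x :: "'a::{field,finite}"
  shows "x ^ CARD('a) = x"
proof (cases "x = 0")
  case False
  have "x ^ CARD('a) = x ^ Suc (CARD('a) - 1)" by simp
  also have "\<dots> = x * x ^ (CARD('a) - 1)" by (rule power_Suc)
  finally show ?thesis using power_card_minus_1_eq_1[OF False] by simp
qed (simp add: power_0_left)

lemma of_nat_CARD_eq_0: "(of_nat CARD('a) :: 'a::{ring_1,finite}) = 0"
  using CHAR_dvd_CARD by (simp add: of_nat_eq_0_iff_char_dvd)

lemma CHAR_eq_of_card_prime_power:
  assumes "prime p" "CARD('a::{field,finite}) = p ^ m"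
  shows "CHAR('a) = p"
proof -
  have pr: "prime CHAR('a)" by (intro prime_CHAR_semidom finite_imp_CHAR_pos) auto
  have "CHAR('a) dvd p ^ m" using CHAR_dvd_CARD[where 'a = 'a] assms(2) by simp
  hence "CHAR('a) dvd p" using pr prime_dvd_power by blast
  thus ?thesis using pr assms(1) by (simp add: primes_dvd_imp_eq)
qed

lemma power_residues_eq_roots_of_unity:
  assumes "CARD('a::{field,finite}) = k * n + 1" "k > 0" "n > 0"
  shows "power_residues k = {x::'a. x ^ n = 1}" "card (power_residues k :: 'a set) = n"
proof -
  let ?R = "power_residues k :: 'a set"
  have sub: "?R \<subseteq> {x. x ^ n = 1}"
  proof
    fix y :: 'a assume "y \<in> ?R"
    then obtain x where x: "x \<noteq> 0" "y = x ^ k" by (auto simp: power_residues_def)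
    have "x ^ (k * n) = 1" using power_card_minus_1_eq_1[OF x(1)] assms(1) by simp
    thus "y \<in> {x. x ^ n = 1}" by (simp add: x(2) power_mult)
  qed
  have "card (UNIV - {0::'a}) = card (\<Union>y\<in>?R. {x. x ^ k = y})"
    using assms(2) by (intro arg_cong[of _ _ card]) (auto simp: power_residues_def power_0_left)
  also have "\<dots> \<le> (\<Sum>y\<in>?R. card {x. x ^ k = y})" by (rule card_UN_le) simp
  also have "\<dots> \<le> (\<Sum>y\<in>?R. k)" using assms(2) by (intro sum_mono card_nth_roots_le)
  \<comment> \<open>Each power has at most \<open>k\<close> roots of order \<open>k\<close>, so there are at least \<open>n\<close> powers.\<close>
  finally have "k * n \<le> k * card ?R" using assms(1) by (simp add: card_Diff_singleton mult.commute)
  hence le: "n \<le> card ?R" using assms(2) by simp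
  have "card {x::'a. x ^ n = 1} \<le> n" using assms(3) by (rule card_nth_roots_le)
  thus "?R = {x. x ^ n = 1}" using le sub by (intro card_seteq) auto
  with le \<open>card {x::'a. x ^ n = 1} \<le> n\<close> show "card ?R = n" by simp
qed

lemma sum_powers_eq:
  "(\<Sum>x\<in>UNIV. x ^ l :: 'a::{field,finite}) = (if l > 0 \<and> CARD('a) - 1 dvd l then - 1 else 0)"
proof -
  define N where "N = CARD('a) - 1"
  have "card {0, 1 :: 'a} \<le> CARD('a)" by (intro card_mono) auto
  hence N0: "N > 0" by (simp add: N_def)
  have of_nat_N: "(of_nat N :: 'a) = - 1"
  proof -
    have "CARD('a) = N + 1" by (simp add: N_def)
    hence "(of_nat (N + 1) :: 'a) = 0" using of_nat_CARD_eq_0[where 'a = 'a] by simp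
    hence "(of_nat N + 1 :: 'a) = 0" by (simp add: add.commute)
    thus ?thesis by (simp add: eq_neg_iff_add_eq_0)
  qed
  have red: "x ^ l = x ^ (l mod N)" if "x \<noteq> 0" for x :: 'a
  proof -
    have "x ^ l = x ^ (N * (l div N) + l mod N)" by simp
    also have "\<dots> = (x ^ N) ^ (l div N) * x ^ (l mod N)" by (simp only: power_add power_mult)
    finally show ?thesis using power_card_minus_1_eq_1[OF that] by (simp add: N_def)
  qed
  consider "l = 0" | "l > 0" "N dvd l" | "l > 0" "\<not> N dvd l" by blast
  thus ?thesis
  proof cases
    case 1
    thus ?thesis using of_nat_CARD_eq_0[where 'a = 'a] by simp
  next
    case 2
    have "(\<Sum>x\<in>UNIV. x ^ l :: 'a) = (\<Sum>x\<in>UNIV - {0}. x ^ l)"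
      using 2(1) by (intro sum.mono_neutral_right) auto
    also have "\<dots> = (\<Sum>x\<in>UNIV - {0::'a}. 1)" using 2(2) red by (intro sum.cong) auto
    also have "\<dots> = of_nat N" by (simp add: N_def card_Diff_singleton)
    finally show ?thesis using 2 of_nat_N by (simp add: N_def)
  next
    case 3
    define r where "r = l mod N"
    have r: "0 < r" "r < N" using 3(2) N0 by (auto simp: r_def mod_greater_zero_iff_not_dvd)
    have "\<exists>a::'a. a \<noteq> 0 \<and> a ^ r \<noteq> 1"
    proof (rule ccontr)
      assume "\<not> ?thesis"
      hence "UNIV - {0} \<subseteq> {x::'a. x ^ r = 1}" by auto
      hence "card (UNIV - {0::'a}) \<le> card {x::'a. x ^ r = 1}" by (intro card_mono) auto
      hence "N \<le> card {x::'a. x ^ r = 1}" by (simp add: N_def card_Diff_singleton)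
      thus False using card_nth_roots_le[OF r(1), of "1::'a"] r(2) by simp
    qed
    then obtain a :: 'a where a: "a \<noteq> 0" "a ^ l \<noteq> 1" using red by (auto simp: r_def)
    have "(\<Sum>x\<in>UNIV. x ^ l) = (\<Sum>x\<in>UNIV. (a * x) ^ l)"
      by (rule sum.reindex_bij_witness[of _ "\<lambda>y. a * y" "\<lambda>y. y / a"]) (use a in auto)
    also have "\<dots> = a ^ l * (\<Sum>x\<in>UNIV. x ^ l)" by (simp add: power_mult_distrib sum_distrib_left)
    finally have "(\<Sum>x\<in>UNIV. x ^ l :: 'a) = 0" using a(2) unfolding mult_cancel_right1 by blast
    thus ?thesis using 3 by (simp add: N_def)
  qed
qed

section \<open>Additive characters\<close>

text \<open>
  The character is $x \mapsto \exp(2\pi i \, \mathrm{tr}(x) / p)$ for the absolute trace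
  $\mathrm{tr}(x) = \sum_{i<m} x^{p^i}$, which takes values in the prime field and, being a nonzero polynomial
  of degree at most $p^{m-1}$, does not vanish identically.
\<close>
lemma exists_nontrivial_additive_character:
  assumes p: "prime p" and card: "CARD('a::{field,finite}) = p ^ m"
  obtains \<psi> :: "'a::{field,finite} \<Rightarrow> complex"
  where "\<And>x y. \<psi> (x + y) = \<psi> x * \<psi> y" "\<And>x. norm (\<psi> x) = 1" "\<exists>x. \<psi> x \<noteq> 1"
proof -
  have char: "CHAR('a) = p" using CHAR_eq_of_card_prime_power[OF p card] .
  have pr: "prime CHAR('a)" using char p by simp
  have p2: "p \<ge> 2" using p by (rule prime_ge_2_nat)
  define tr :: "'a \<Rightarrow> 'a" where "tr x = (\<Sum>i<m. x ^ (p ^ i))" for x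
  have tr_add: "tr (x + y) = tr x + tr y" for x y
    unfolding tr_def sum.distrib[symmetric]
    by (intro sum.cong refl freshmans_dream'[OF pr]) (simp add: char)
  have m0: "m > 0"
  proof (rule ccontr)
    assume "\<not> m > 0"
    hence "CARD('a) = 1" using card by simp
    moreover have "card {0, 1 :: 'a} \<le> CARD('a)" by (intro card_mono) auto
    ultimately show False by simp
  qed
  have tr_frob: "tr x ^ p = tr x" for x
  proof -
    have "tr x ^ p = (\<Sum>i<m. x ^ (p ^ Suc i))"
      unfolding tr_def using char pr
      by (subst freshmans_dream_sum) (auto simp: mult.commute simp flip: power_mult)
    also have "\<dots> + x ^ (p ^ 0) = tr x + x ^ (p ^ m)"
      using sum.lessThan_Suc[of "\<lambda>i. x ^ (p ^ i)" m] sum.lessThan_Suc_shift[of "\<lambda>i. x ^ (p ^ i)" m]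
      by (simp add: tr_def add.commute)
    also have "x ^ (p ^ m) = x" unfolding card[symmetric] by (rule power_card_eq_same)
    finally show ?thesis by simp
  qed
  \<comment> \<open>The fixed points of the Frobenius map are the elements of the prime field.\<close>
  have prime_field: "{y::'a. y ^ p = y} = of_nat ` {..<p}"
  proof (rule sym, rule card_seteq)
    show "of_nat ` {..<p} \<subseteq> {y::'a. y ^ p = y}"
    proof safe
      fix k
      show "(of_nat k :: 'a) ^ p = of_nat k"
        using p2 char pr by (induction k) (auto simp: freshmans_dream power_0_left)
    qed
    have "{y::'a. y ^ p = y} \<subseteq> insert 0 {y. y ^ (p - 1) = 1}"
    proof
      fix y :: 'a assume "y \<in> {y. y ^ p = y}"
      hence "y ^ Suc (p - 1) = y" using p2 by simp
      hence "y * y ^ (p - 1) = y * 1" by (simp only: power_Suc mult_1_right)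
      thus "y \<in> insert 0 {y. y ^ (p - 1) = 1}" by (simp only: mult_cancel_left) auto
    qed
    hence "card {y::'a. y ^ p = y} \<le> card (insert 0 {y::'a. y ^ (p - 1) = 1})"
      by (intro card_mono) auto
    also have "\<dots> \<le> Suc (card {y::'a. y ^ (p - 1) = 1})" by (rule card_insert_le_m1) auto
    also have "\<dots> \<le> p" using card_nth_roots_le[of "p - 1" "1::'a"] p2 by simp
    also have "p = card (of_nat ` {..<p} :: 'a set)"
    proof -
      have "inj_on (of_nat :: nat \<Rightarrow> 'a) {..<p}"
        by (auto simp: inj_on_def of_nat_eq_iff_cong_CHAR char cong_def)
      thus ?thesis by (simp add: card_image)
    qed
    finally show "card {y::'a. y ^ p = y} \<le> card (of_nat ` {..<p} :: 'a set)" .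
  qed auto
  have "\<exists>k. tr x = of_nat k" for x
    using tr_frob[of x] prime_field by blast
  then obtain k where k: "\<And>x. tr x = of_nat (k x)" by metis
  have "\<exists>x. tr x \<noteq> 0"
  proof (rule ccontr)
    assume "\<not> ?thesis"
    hence all: "{x. tr x = 0} = UNIV" by auto
    define T :: "'a poly" where "T = (\<Sum>i<m. Polynomial.monom 1 (p ^ i))"
    have "Polynomial.coeff T 1 = (\<Sum>i<m. if i = 0 then 1 else 0)"
      unfolding T_def coeff_sum using p2 by (intro sum.cong) auto
    hence "T \<noteq> 0" using m0 by auto
    hence "card {x. poly T x = 0} \<le> Polynomial.degree T" by (rule card_poly_roots_bound)
    also have "\<dots> \<le> p ^ (m - 1)"
      unfolding T_def
    proof (intro degree_sum_le)
      fix i assume "i \<in> {..<m}"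
      hence "p ^ i \<le> p ^ (m - 1)" using p2 by (intro power_increasing) auto
      thus "Polynomial.degree (Polynomial.monom (1::'a) (p ^ i)) \<le> p ^ (m - 1)" by (simp add: degree_monom_eq)
    qed auto
    also have "\<dots> < p ^ m" using p2 m0 by simp
    also have "{x. poly T x = 0} = {x. tr x = 0}" by (simp add: T_def tr_def poly_sum poly_monom)
    finally show False using all card by simp
  qed
  then obtain z where z: "tr z \<noteq> 0" by blast
  define \<psi> where "\<psi> x = exp (2 * of_real pi * \<i> * of_nat (k x) / of_nat p)" for x
  have eq: "exp (2 * of_real pi * \<i> * of_nat a / of_nat p) = exp (2 * of_real pi * \<i> * of_nat b / of_nat p)"
    if "(of_nat a :: 'a) = of_nat b" for a b
    using that complex_root_unity_eq[of p a b] p2 by (simp add: of_nat_eq_iff_cong_CHAR char cong_def)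
  show ?thesis
  proof (rule that[of \<psi>])
    fix x y
    have "(of_nat (k (x + y)) :: 'a) = of_nat (k x + k y)" using tr_add[of x y] by (simp add: k)
    from eq[OF this] show "\<psi> (x + y) = \<psi> x * \<psi> y"
      by (simp add: \<psi>_def algebra_simps add_divide_distrib flip: exp_add)
  next
    fix x
    show "norm (\<psi> x) = 1" by (simp add: \<psi>_def)
  next
    have "\<psi> z \<noteq> 1"
      using z p2 k[of z] unfolding \<psi>_def by (subst complex_root_unity_eq_1) (auto simp: of_nat_eq_0_iff_char_dvd char)
    thus "\<exists>x. \<psi> x \<noteq> 1" by blast
  qed
qed

lemma additive_character_orthogonality:
  fixes \<psi> :: "'a::{field,finite} \<Rightarrow> complex"
  assumes add: "\<And>x y. \<psi> (x + y) = \<psi> x * \<psi> y" and nz: "\<And>x. \<psi> x \<noteq> 0" and nontriv: "\<psi> z \<noteq> 1"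
  shows "(\<Sum>c\<in>UNIV. \<psi> (c * x)) = (if x = 0 then of_nat CARD('a) else 0)"
proof (cases "x = 0")
  case True
  have "\<psi> 0 = 1" using add[of 0 0] nz[of 0] by simp
  thus ?thesis using True by simp
next
  case False
  have "(\<Sum>c\<in>UNIV. \<psi> (c * x)) = (\<Sum>c\<in>UNIV. \<psi> c)"
    by (rule sum.reindex_bij_witness[of _ "\<lambda>c. c / x" "\<lambda>c. c * x"]) (use False in auto)
  moreover have "(\<Sum>c\<in>UNIV. \<psi> c) = (\<Sum>c\<in>UNIV. \<psi> (z + c))"
    by (rule sum.reindex_bij_witness[of _ "\<lambda>c. z + c" "\<lambda>c. c - z"]) auto
  hence "(\<Sum>c\<in>UNIV. \<psi> c) = \<psi> z * (\<Sum>c\<in>UNIV. \<psi> c)" unfolding add sum_distrib_left .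
  hence "(\<Sum>c\<in>UNIV. \<psi> c) = 0" using nontriv unfolding mult_cancel_right1 by blast
  ultimately show ?thesis using False by simp
qed

section \<open>A central binomial coefficient modulo p\<close>

lemma coeff_one_plus_X_power: "Polynomial.coeff ([:1, 1:] ^ b :: 'a::comm_ring_1 poly) k = of_nat (b choose k)"
proof -
  have "([:1, 1:] :: 'a poly) ^ b = (Polynomial.monom 1 1 + 1) ^ b" by (simp add: monom_altdef one_pCons)
  also have "\<dots> = (\<Sum>j\<le>b. Polynomial.monom (of_nat (b choose j)) j)"
    by (simp add: binomial_ring monom_power of_nat_poly smult_monom)
  finally show ?thesis by (simp add: coeff_sum binomial_eq_0)
qed

text \<open>
  One step of Lucas's theorem in characteristic \<open>p\<close>, read off from the coefficients of
  $(1+X)^{pa+b} = (1+X^p)^a (1+X)^b$.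
\<close>
lemma of_nat_choose_lucas:
  fixes p a b c d :: nat
  assumes char: "CHAR('a::comm_ring_1) = p" and p: "prime p" and bd: "b < p" "d \<le> b"
  shows "(of_nat ((p * a + b) choose (p * c + d)) :: 'a) = of_nat (a choose c) * of_nat (b choose d)"
proof -
  let ?X = "[:1, 1:] :: 'a poly"
  have "?X ^ p = (Polynomial.monom 1 1 + 1) ^ p" by (simp add: monom_altdef one_pCons)
  also have "\<dots> = Polynomial.monom 1 p + 1" using p char by (subst freshmans_dream) (auto simp: monom_power)
  finally have "?X ^ (p * a) = (Polynomial.monom 1 p + 1) ^ a" by (simp add: power_mult)
  also have "\<dots> = (\<Sum>j\<le>a. Polynomial.monom (of_nat (a choose j)) (p * j))"
    by (simp add: binomial_ring monom_power of_nat_poly smult_monom)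
  finally have "?X ^ (p * a + b) = (\<Sum>j\<le>a. Polynomial.monom (of_nat (a choose j)) (p * j)) * ?X ^ b"
    by (simp add: power_add)
  hence "of_nat ((p * a + b) choose (p * c + d)) = Polynomial.coeff ((\<Sum>j\<le>a. Polynomial.monom (of_nat (a choose j)) (p * j)) * ?X ^ b) (p * c + d)"
    by (metis coeff_one_plus_X_power)
  also have "\<dots> = (\<Sum>j\<le>a. Polynomial.coeff (Polynomial.monom (of_nat (a choose j)) (p * j) * ?X ^ b) (p * c + d))"
    by (simp add: sum_distrib_right coeff_sum)
  also have "\<dots> = (\<Sum>j\<le>a. if j = c then of_nat (a choose c) * of_nat (b choose d) else 0)"
  proof (intro sum.cong refl)
    fix j
    consider "j = c" | "j < c" | "j > c" by linarith
    thus "Polynomial.coeff (Polynomial.monom (of_nat (a choose j)) (p * j) * ?X ^ b) (p * c + d)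
       = (if j = c then of_nat (a choose c) * of_nat (b choose d) else 0 :: 'a)"
    proof cases
      case 1
      thus ?thesis by (simp add: coeff_monom_mult coeff_one_plus_X_power)
    next
      case 2
      hence "p * Suc j \<le> p * c" by (intro mult_le_mono) auto
      hence "p * c + d - p * j > b" using bd by simp
      thus ?thesis using 2 by (simp add: coeff_monom_mult coeff_one_plus_X_power binomial_eq_0)
    next
      case 3
      hence "p * Suc c \<le> p * j" by (intro mult_le_mono) auto
      hence "p * c + d < p * j" using bd by simp
      thus ?thesis using 3 by (simp add: coeff_monom_mult)
    qed
  qed
  also have "\<dots> = of_nat (a choose c) * of_nat (b choose d)" by (simp add: binomial_eq_0)
  finally show ?thesis .
qed

text \<open>
  All base-\<open>p\<close> digits of $(p^m-1)/3$ are equal to $d = (p-1)/3$, and doubling them produces no carry.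
\<close>
lemma central_binomial_third_nonzero:
  fixes p m :: nat
  assumes char: "CHAR('a::idom) = p" and p: "prime p" "[p = 1] (mod 3)"
  shows "(of_nat ((2 * ((p ^ m - 1) div 3)) choose ((p ^ m - 1) div 3)) :: 'a) \<noteq> 0"
proof (induction m)
  case 0
  show ?case by simp
next
  case (Suc m)
  define d where "d = (p - 1) div 3"
  define n where "n = (p ^ m - 1) div 3"
  have p3: "p mod 3 = 1" using p(2) by (simp add: cong_def)
  have d: "p = 3 * d + 1" using p3 unfolding d_def by presburger
  have "[p ^ m = 1 ^ m] (mod 3)" using p(2) by (rule cong_pow)
  hence "p ^ m mod 3 = 1" by (simp add: cong_def)
  hence n: "p ^ m = 3 * n + 1" unfolding n_def by presburger
  have "p ^ Suc m = p * (3 * n + 1)" by (simp add: n)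
  also have "\<dots> = 3 * (p * n + d) + 1" using d by (simp add: algebra_simps)
  finally have step: "(p ^ Suc m - 1) div 3 = p * n + d" by simp
  have "of_nat ((2 * (p * n + d)) choose (p * n + d)) = (of_nat ((2 * n) choose n) * of_nat ((2 * d) choose d) :: 'a)"
    using of_nat_choose_lucas[OF char p(1), of "2 * d" d "2 * n" n] d by (simp add: algebra_simps)
  moreover have "(of_nat ((2 * d) choose d) :: 'a) \<noteq> 0"
  proof
    assume "(of_nat ((2 * d) choose d) :: 'a) = 0"
    hence "p dvd (2 * d) choose d" by (simp add: of_nat_eq_0_iff_char_dvd char)
    also have "\<dots> dvd fact (2 * d)"
      using binomial_fact_lemma[of d "2 * d"] by (metis dvd_triv_right le_add2 mult_2)
    finally have "p \<le> 2 * d" using p(1) by (simp add: prime_dvd_fact_iff)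
    thus False using d by simp
  qed
  ultimately show ?case unfolding step using Suc.IH by (simp add: n_def)
qed

section \<open>Cubic Gauss periods\<close>

text \<open>
  A field with $3n+1$ elements, a nontrivial unitary additive character \<open>\<psi>\<close>, and a representative \<open>g\<close> of a
  nontrivial coset of the cubes: $g^n$ is a primitive cube root of unity.
\<close>
locale cubic_periods =
  fixes \<psi> :: "'a::{field,finite} \<Rightarrow> complex" and n :: nat and g :: 'a
  assumes card: "CARD('a) = 3 * n + 1" and n_pos: "n > 0"
    and g: "g \<noteq> 0" "g ^ n \<noteq> 1"
    and add: "\<psi> (x + y) = \<psi> x * \<psi> y"
    and norm: "norm (\<psi> x) = 1" and nontriv: "\<exists>x. \<psi> x \<noteq> 1"
begin

text \<open>The group of nonzero cubes, described as the group of \<open>n\<close>-th roots of unity.\<close>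
definition R :: "'a set" where "R = {x. x ^ n = 1}"

text \<open>
  The cubic Gauss period attached to \<open>c\<close>. It is the eigenvalue of the Paley graph belonging to the character
  $x \mapsto \psi(cx)$, and for nonzero \<open>c\<close> it depends only on the coset of \<open>c\<close> modulo the cubes.
\<close>
definition period :: "'a \<Rightarrow> complex" where "period c = (\<Sum>r\<in>R. \<psi> (c * r))"

lemma power_residues_3: "power_residues 3 = R"
  unfolding R_def using card n_pos by (intro power_residues_eq_roots_of_unity) auto

lemma card_R: "card R = n"
  using power_residues_eq_roots_of_unity(2)[of 3 n, where 'a = 'a] card n_pos power_residues_3 by simp

lemma one_in_R: "1 \<in> R" by (simp add: R_def)

lemma zero_notin_R: "0 \<notin> R" using n_pos by (simp add: R_def power_0_left)

lemma mult_in_R: "x \<in> R \<Longrightarrow> y \<in> R \<Longrightarrow> x * y \<in> R" by (simp add: R_def power_mult_distrib)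

lemma divide_in_R: "x \<in> R \<Longrightarrow> y \<in> R \<Longrightarrow> x / y \<in> R" by (simp add: R_def power_divide)

lemma cube_in_R: "x \<noteq> 0 \<Longrightarrow> x ^ 3 \<in> R"
  unfolding power_residues_3[symmetric] by (auto simp: power_residues_def)

lemma minus_one_in_R: "- 1 \<in> R" using cube_in_R[of "- 1"] by simp

lemma uminus_in_R: "x \<in> R \<Longrightarrow> - x \<in> R" using mult_in_R[OF minus_one_in_R, of x] by simp

lemma uminus_in_R_iff: "- x \<in> R \<longleftrightarrow> x \<in> R" using uminus_in_R[of x] uminus_in_R[of "- x"] by auto

lemma cube_root_of_unity: "(g ^ n) ^ 3 = 1" "1 + g ^ n + (g ^ n) ^ 2 = 0"
proof -
  show *: "(g ^ n) ^ 3 = 1"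
    using power_card_minus_1_eq_1[OF g(1)] card by (simp add: mult.commute flip: power_mult)
  have "(g ^ n - 1) * (1 + g ^ n + (g ^ n) ^ 2) = (g ^ n) ^ 3 - 1"
    by (simp add: power2_eq_square power3_eq_cube algebra_simps)
  thus "1 + g ^ n + (g ^ n) ^ 2 = 0" using * g(2) by simp
qed

lemma power_n_cases:
  assumes "x \<noteq> 0"
  shows "x ^ n = 1 \<or> x ^ n = g ^ n \<or> x ^ n = (g ^ n) ^ 2"
proof -
  define z where "z = x ^ n"
  define w where "w = g ^ n"
  have w: "w ^ 3 = 1" "1 + w + w ^ 2 = 0" using cube_root_of_unity by (simp_all add: w_def)
  have z: "z ^ 3 = 1"
    using power_card_minus_1_eq_1[OF assms] card by (simp add: z_def mult.commute flip: power_mult)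
  have "(z - 1) * ((z - w) * (z - w ^ 2)) = z ^ 3 - (1 + w + w ^ 2) * z ^ 2 + w * (1 + w + w ^ 2) * z - w ^ 3"
    by (simp add: power2_eq_square power3_eq_cube algebra_simps)
  also have "\<dots> = 0" using w z by simp
  finally show ?thesis unfolding z_def[symmetric] w_def[symmetric] by auto
qed

text \<open>
  The nonzero elements are the disjoint union of the cosets of $1$, $g$ and $g^2$, distinguished by the value
  of $x^n$.
\<close>
lemma sum_nonzero_by_cosets:
  fixes f :: "'a \<Rightarrow> 'b::comm_monoid_add"
  assumes inv: "\<And>x r. r \<in> R \<Longrightarrow> f (x * r) = f x"
  shows "(\<Sum>x\<in>UNIV - {0}. f x) = (\<Sum>r\<in>R. f 1) + (\<Sum>r\<in>R. f g) + (\<Sum>r\<in>R. f (g ^ 2))"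
proof -
  define w where "w = g ^ n"
  define C where "C i = {x::'a. x ^ n = w ^ i}" for i :: nat
  have w: "w ^ 3 = 1" "w \<noteq> 1" "w \<noteq> 0" using cube_root_of_unity g by (simp_all add: w_def)
  have w2: "w ^ 2 \<noteq> 1" "w ^ 2 \<noteq> w"
    using w by (auto simp: power2_eq_square power3_eq_cube)
  have part: "UNIV - {0} = C 0 \<union> C 1 \<union> C 2"
    using power_n_cases w(3) n_pos by (auto simp: C_def w_def power_0_left)
  have coset: "(\<Sum>x\<in>C i. f x) = (\<Sum>r\<in>R. f (g ^ i))" for i
  proof -
    have "(\<Sum>x\<in>C i. f x) = (\<Sum>r\<in>R. f (g ^ i * r))"
      using g(1) by (intro sum.reindex_bij_witness[of _ "\<lambda>r. g ^ i * r" "\<lambda>x. x / g ^ i"])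
        (auto simp: C_def R_def w_def power_mult_distrib power_divide mult.commute simp flip: power_mult)
    thus ?thesis using inv by simp
  qed
  have "(\<Sum>x\<in>UNIV - {0}. f x) = (\<Sum>x\<in>C 0 \<union> C 1. f x) + (\<Sum>x\<in>C 2. f x)"
    unfolding part using w2 by (intro sum.union_disjoint) (auto simp: C_def)
  also have "(\<Sum>x\<in>C 0 \<union> C 1. f x) = (\<Sum>x\<in>C 0. f x) + (\<Sum>x\<in>C 1. f x)"
    using w by (intro sum.union_disjoint) (auto simp: C_def)
  finally show ?thesis unfolding coset by simp
qed

lemma psi_0: "\<psi> 0 = 1"
proof -
  have "\<psi> 0 \<noteq> 0" using norm[of 0] by auto
  thus ?thesis using add[of 0 0] by simp
qed

lemma psi_uminus: "\<psi> (- x) = cnj (\<psi> x)"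
proof -
  have "\<psi> x * \<psi> (- x) = \<psi> x * cnj (\<psi> x)"
    using add[of x "- x"] psi_0 norm[of x] by (simp add: complex_norm_square[symmetric])
  moreover have "\<psi> x \<noteq> 0" using norm[of x] by auto
  ultimately show ?thesis by simp
qed

lemma orthogonality: "(\<Sum>c\<in>UNIV. \<psi> (c * x)) = (if x = 0 then of_nat (3 * n + 1) else 0)"
proof -
  obtain z where z: "\<psi> z \<noteq> 1" using nontriv by blast
  have nz: "\<psi> x \<noteq> 0" for x using norm[of x] by auto
  show ?thesis using additive_character_orthogonality[of \<psi>, OF add nz z] unfolding card .
qed

lemma period_0: "period 0 = of_nat n" by (simp add: period_def psi_0 card_R)

lemma period_mult_R: "r \<in> R \<Longrightarrow> period (x * r) = period x"
  unfolding period_def using zero_notin_R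
  by (intro sum.reindex_bij_witness[of _ "\<lambda>s. s / r" "\<lambda>s. r * s"])
     (auto intro: mult_in_R divide_in_R simp: mult.assoc)

lemma period_real: "period x \<in> \<real>"
proof -
  have "cnj (period x) = (\<Sum>r\<in>R. \<psi> (x * (- r)))" by (simp add: period_def flip: psi_uminus)
  also have "\<dots> = period x" unfolding period_def
    by (rule sum.reindex_bij_witness[of _ uminus uminus]) (auto simp: uminus_in_R_iff)
  finally show ?thesis by (simp add: complex_is_Real_iff complex_eq_iff)
qed

lemma sum_period: "(\<Sum>c\<in>UNIV. period c) = 0"
proof -
  have "(\<Sum>c\<in>UNIV. period c) = (\<Sum>r\<in>R. \<Sum>c\<in>UNIV. \<psi> (c * r))"
    unfolding period_def by (rule sum.swap)
  also have "\<dots> = 0" using zero_notin_R by (intro sum.neutral) (auto simp: orthogonality)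
  finally show ?thesis .
qed

lemma sum_period_2: "(\<Sum>c\<in>UNIV. period c ^ 2) = of_nat (3 * n + 1) * of_nat n"
proof -
  have "(\<Sum>c\<in>UNIV. period c ^ 2) = (\<Sum>c\<in>UNIV. \<Sum>z\<in>R \<times> R. \<psi> (c * (fst z + snd z)))"
    by (simp add: power2_eq_square period_def sum_product sum.cartesian_product case_prod_beta
        distrib_left add)
  also have "\<dots> = (\<Sum>z\<in>R \<times> R. if fst z + snd z = 0 then of_nat (3 * n + 1) else 0)"
    by (subst sum.swap) (simp only: orthogonality)
  also have "\<dots> = (\<Sum>z | z \<in> R \<times> R \<and> fst z + snd z = 0. of_nat (3 * n + 1))"
    by (rule sum.inter_filter[symmetric]) simp
  also have "{z. z \<in> R \<times> R \<and> fst z + snd z = 0} = (\<lambda>r. (r, - r)) ` R"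
    by (auto simp: uminus_in_R image_iff add_eq_0_iff)
  also have "(\<Sum>z\<in>\<dots>. of_nat (3 * n + 1) :: complex) = of_nat (3 * n + 1) * of_nat n"
    by (subst sum.reindex) (auto simp: inj_on_def card_R)
  finally show ?thesis .
qed

text \<open>The number of pairs of cubes \<open>r\<close>, \<open>s\<close> with $ur + vs + w = 0$.\<close>
definition sol :: "'a \<Rightarrow> 'a \<Rightarrow> 'a \<Rightarrow> nat"
  where "sol u v w = card {(r, s). r \<in> R \<and> s \<in> R \<and> u * r + v * s + w = 0}"

text \<open>
  By orthogonality the sum counts triples of cubes with $ur + vs + wt = 0$; dividing such a triple by \<open>t\<close>
  leaves a pair counted by \<open>sol\<close> and a free choice of \<open>t\<close>.
\<close>
lemma sum_period_3:
  "(\<Sum>c\<in>UNIV. period (u * c) * period (v * c) * period (w * c)) = of_nat (3 * n + 1) * of_nat n * of_nat (sol u v w)"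
proof -
  define L where "L = (\<lambda>(r, t, s). u * r + v * s + w * t)"
  define S where "S = {(r, s). r \<in> R \<and> s \<in> R \<and> u * r + v * s + w = 0}"
  have "period (u * c) * period (v * c) * period (w * c) = (\<Sum>z\<in>R \<times> R \<times> R. \<psi> (c * L z))" for c
  proof -
    have "period (u * c) * period (v * c) * period (w * c)
        = (\<Sum>r\<in>R. \<Sum>t\<in>R. \<Sum>s\<in>R. \<psi> (u * c * r) * \<psi> (v * c * s) * \<psi> (w * c * t))"
      unfolding period_def sum_product by (simp only: sum_distrib_right)
    also have "\<dots> = (\<Sum>z\<in>R \<times> R \<times> R. \<psi> (c * L z))"
      by (simp add: sum.cartesian_product case_prod_beta L_def distrib_left add mult_ac)
    finally show ?thesis .
  qed
  hence "(\<Sum>c\<in>UNIV. period (u * c) * period (v * c) * period (w * c)) = (\<Sum>z\<in>R \<times> R \<times> R. \<Sum>c\<in>UNIV. \<psi> (c * L z))"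
    by (simp add: sum.swap[of _ UNIV])
  also have "\<dots> = (\<Sum>z\<in>R \<times> R \<times> R. if L z = 0 then of_nat (3 * n + 1) else 0)"
    by (simp only: orthogonality)
  also have "\<dots> = (\<Sum>z | z \<in> R \<times> R \<times> R \<and> L z = 0. of_nat (3 * n + 1))"
    by (rule sum.inter_filter[symmetric]) simp
  also have "\<dots> = of_nat (3 * n + 1) * of_nat (card {z. z \<in> R \<times> R \<times> R \<and> L z = 0})" by simp
  also have "card {z. z \<in> R \<times> R \<times> R \<and> L z = 0} = card (S \<times> R)"
  proof (rule bij_betw_same_card[symmetric])
    show "bij_betw (\<lambda>((r, s), t). (r * t, t, s * t)) (S \<times> R) {z. z \<in> R \<times> R \<times> R \<and> L z = 0}"
    proof (rule bij_betw_byWitness[where f' = "\<lambda>(r, t, s). ((r / t, s / t), t)"])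
      show "\<forall>a\<in>S \<times> R. (\<lambda>(r, t, s). ((r / t, s / t), t)) ((\<lambda>((r, s), t). (r * t, t, s * t)) a) = a"
        using zero_notin_R by auto
      show "\<forall>a\<in>{z. z \<in> R \<times> R \<times> R \<and> L z = 0}.
        (\<lambda>((r, s), t). (r * t, t, s * t)) ((\<lambda>(r, t, s). ((r / t, s / t), t)) a) = a"
      proof
        fix z assume z: "z \<in> {z. z \<in> R \<times> R \<times> R \<and> L z = 0}"
        obtain r t s where rts: "z = (r, t, s)" by (cases z)
        have "t \<noteq> 0" using z zero_notin_R unfolding rts by blast
        thus "(\<lambda>((r, s), t). (r * t, t, s * t)) ((\<lambda>(r, t, s). ((r / t, s / t), t)) z) = z"
          by (simp add: rts)
      qed
      have "L (r * t, t, s * t) = t * (u * r + v * s + w)" for r s t by (simp add: L_def algebra_simps)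
      thus "(\<lambda>((r, s), t). (r * t, t, s * t)) ` (S \<times> R) \<subseteq> {z. z \<in> R \<times> R \<times> R \<and> L z = 0}"
        by (auto simp: S_def mult_in_R)
      have "u * (r / t) + v * (s / t) + w = L (r, t, s) / t" if "t \<in> R" for r s t
        using that zero_notin_R by (auto simp: L_def add_divide_distrib)
      thus "(\<lambda>(r, t, s). ((r / t, s / t), t)) ` {z. z \<in> R \<times> R \<times> R \<and> L z = 0} \<subseteq> S \<times> R"
        by (auto simp: S_def divide_in_R)
    qed
  qed
  also have "card (S \<times> R) = n * sol u v w"
    by (simp add: card_cartesian_product card_R sol_def S_def)
  finally show ?thesis by simp
qed

text \<open>The three cubic Gauss periods.\<close>
definition e0 where "e0 = period 1"
definition e1 where "e1 = period g"
definition e2 where "e2 = period (g ^ 2)"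

lemma period_g_cube: "period (g * g ^ 2) = e0"
  using period_mult_R[OF cube_in_R[OF g(1)], of 1] by (simp add: e0_def power3_eq_cube power2_eq_square mult.assoc)

lemma sum_by_periods:
  fixes f :: "'a \<Rightarrow> complex"
  assumes "\<And>x r. r \<in> R \<Longrightarrow> f (x * r) = f x"
  shows "(\<Sum>c\<in>UNIV. f c) = f 0 + of_nat n * (f 1 + f g + f (g ^ 2))"
proof -
  have "(\<Sum>c\<in>UNIV. f c) = f 0 + (\<Sum>c\<in>UNIV - {0}. f c)" by (rule sum.remove) auto
  thus ?thesis using sum_nonzero_by_cosets[of f, OF assms] by (simp add: card_R algebra_simps)
qed

lemma period_sums:
  shows "e0 + e1 + e2 = - 1"
    and "e0 ^ 2 + e1 ^ 2 + e2 ^ 2 = of_nat (3 * n + 1) - of_nat n"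
    and "e0 ^ 3 + e1 ^ 3 + e2 ^ 3 = of_nat (3 * n + 1) * of_nat (sol 1 1 1) - of_nat n ^ 2"
    and "e0 ^ 2 * e1 + e1 ^ 2 * e2 + e2 ^ 2 * e0 = of_nat (3 * n + 1) * of_nat (sol 1 1 g) - of_nat n ^ 2"
    and "e0 * e1 ^ 2 + e1 * e2 ^ 2 + e2 * e0 ^ 2 = of_nat (3 * n + 1) * of_nat (sol 1 g g) - of_nat n ^ 2"
proof -
  define N where "N = (of_nat n :: complex)"
  have N: "N \<noteq> 0" using n_pos by (simp add: N_def)
  have cancel: "a = b" if "N + N * a = N * (b + 1)" for a b using that N by (simp add: algebra_simps)
  have cancel3: "a = b - N ^ 2" if "N * N * N + N * a = N * b" for a b
  proof -
    have "N * (N ^ 2 + a) = N * b" using that by (simp add: power2_eq_square algebra_simps)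
    hence "N ^ 2 + a = b" using N by simp
    thus ?thesis by (simp add: algebra_simps)
  qed
  have "N + N * (e0 + e1 + e2) = 0"
    using sum_by_periods[of period, OF period_mult_R] sum_period
    by (simp add: period_0 N_def e0_def e1_def e2_def)
  hence "N + N * (e0 + e1 + e2) = N * (- 1 + 1)" by simp
  thus "e0 + e1 + e2 = - 1" by (rule cancel)
  have "N ^ 2 + N * (e0 ^ 2 + e1 ^ 2 + e2 ^ 2) = of_nat (3 * n + 1) * N"
    using sum_by_periods[of "\<lambda>c. period c ^ 2"] sum_period_2
    by (simp add: period_0 N_def e0_def e1_def e2_def period_mult_R)
  hence "N * (N + (e0 ^ 2 + e1 ^ 2 + e2 ^ 2)) = N * of_nat (3 * n + 1)"
    by (simp add: power2_eq_square algebra_simps)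
  hence "N + (e0 ^ 2 + e1 ^ 2 + e2 ^ 2) = of_nat (3 * n + 1)" using N by (simp only: mult_cancel_left) simp
  thus "e0 ^ 2 + e1 ^ 2 + e2 ^ 2 = of_nat (3 * n + 1) - of_nat n" by (simp add: N_def algebra_simps)
  have inv: "period (u * (x * r)) = period (u * x)" if "r \<in> R" for u x r
    using period_mult_R[OF that, of "u * x"] by (simp add: mult.assoc)
  have main: "period u * period v * period w + period (u * g) * period (v * g) * period (w * g)
      + period (u * g ^ 2) * period (v * g ^ 2) * period (w * g ^ 2)
     = of_nat (3 * n + 1) * of_nat (sol u v w) - N ^ 2" for u v w
  proof (rule cancel3)
    define F where "F c = period (u * c) * period (v * c) * period (w * c)" for c
    have "(\<Sum>c\<in>UNIV. F c) = F 0 + of_nat n * (F 1 + F g + F (g ^ 2))"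
      by (rule sum_by_periods) (simp add: F_def inv)
    moreover have "(\<Sum>c\<in>UNIV. F c) = N * (of_nat (3 * n + 1) * of_nat (sol u v w))"
      unfolding F_def sum_period_3 N_def by (simp only: mult_ac)
    ultimately show "N * N * N + N * (period u * period v * period w + period (u * g) * period (v * g) * period (w * g)
      + period (u * g ^ 2) * period (v * g ^ 2) * period (w * g ^ 2)) = N * (of_nat (3 * n + 1) * of_nat (sol u v w))"
      by (simp add: F_def period_0 N_def)
  qed
  show "e0 ^ 3 + e1 ^ 3 + e2 ^ 3 = of_nat (3 * n + 1) * of_nat (sol 1 1 1) - of_nat n ^ 2"
    using main[of 1 1 1] by (simp add: e0_def e1_def e2_def power3_eq_cube N_def)
  show "e0 ^ 2 * e1 + e1 ^ 2 * e2 + e2 ^ 2 * e0 = of_nat (3 * n + 1) * of_nat (sol 1 1 g) - of_nat n ^ 2"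
    using main[of 1 1 g] period_g_cube by (simp add: e0_def e1_def e2_def power2_eq_square N_def)
  show "e0 * e1 ^ 2 + e1 * e2 ^ 2 + e2 * e0 ^ 2 = of_nat (3 * n + 1) * of_nat (sol 1 g g) - of_nat n ^ 2"
    using main[of 1 g g] period_g_cube by (simp add: e0_def e1_def e2_def power2_eq_square N_def mult.assoc)
qed

text \<open>
  The integers \<open>A\<close> and \<open>B\<close>, given by the numbers of solutions of $r + s + c = 0$ in cubes, for \<open>c\<close> in the three
  cosets: scaling by cubes and by \<open>g\<close> shows that \<open>sol 1 1 g\<close> and \<open>sol 1 g g\<close> belong to the two nontrivial ones.
\<close>
definition A :: int where "A = 9 * int (sol 1 1 1) + 8 - int (3 * n + 1)"
definition B :: int where "B = int (sol 1 1 g) - int (sol 1 g g)"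

lemma A_cong_1: "[A = 1] (mod 3)"
proof -
  have "A - 1 = 3 * (3 * int (sol 1 1 1) + 2 - int n)" by (simp add: A_def)
  thus ?thesis by (simp add: cong_iff_dvd_diff)
qed

text \<open>
  With $y_i = 3e_i + 1$ and $q = 3n+1$, the $y_i$ are the roots of $y^3 - 3qy - qA$. The product of the differences
  of the periods is the difference of the two mixed cubic sums, namely $-qB$; comparing its square with the
  discriminant $27q^2(4q - A^2)$ of the cubic yields the norm equation.
\<close>
lemma period_polynomial:
  defines "y0 \<equiv> 3 * e0 + 1" and "y1 \<equiv> 3 * e1 + 1" and "y2 \<equiv> 3 * e2 + 1"
  shows "y0 + y1 + y2 = 0"
    and "y0 * y1 + y1 * y2 + y2 * y0 = - 3 * of_nat (3 * n + 1)"
    and "y0 * y1 * y2 = of_nat (3 * n + 1) * of_int A"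
    and "4 * int (3 * n + 1) = A ^ 2 + 27 * B ^ 2"
proof -
  define N where "N = (of_nat n :: complex)"
  define Q where "Q = (of_nat (3 * n + 1) :: complex)"
  define t where "t = (of_nat (sol 1 1 1) :: complex)"
  have Q: "Q = 3 * N + 1" by (simp add: Q_def N_def)
  have Q0: "Q \<noteq> 0" unfolding Q_def of_nat_eq_0_iff by simp
  note ps = period_sums[folded Q_def N_def, folded t_def]
  have "y0 + y1 + y2 = 3 * (e0 + e1 + e2) + 3" by (simp add: y0_def y1_def y2_def)
  thus y1: "y0 + y1 + y2 = 0" unfolding ps(1) by simp
  define X where "X = e0 * e1 + e1 * e2 + e2 * e0"
  have "(e0 + e1 + e2) ^ 2 = (e0 ^ 2 + e1 ^ 2 + e2 ^ 2) + 2 * X"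
    by (simp add: X_def power2_eq_square algebra_simps)
  hence "1 = (3 * N + 1 - N) + 2 * X" unfolding ps(1,2) Q by simp
  hence "2 * (X + N) = 0" by (simp add: algebra_simps)
  hence "X + N = 0" unfolding mult_eq_0_iff by simp
  hence "X = - N" by (simp only: eq_neg_iff_add_eq_0)
  hence E2: "e0 * e1 + e1 * e2 + e2 * e0 = - N" unfolding X_def .
  have "y0 * y1 + y1 * y2 + y2 * y0 = 9 * (e0 * e1 + e1 * e2 + e2 * e0) + 6 * (e0 + e1 + e2) + 3"
    by (simp add: y0_def y1_def y2_def algebra_simps)
  thus y2: "y0 * y1 + y1 * y2 + y2 * y0 = - 3 * of_nat (3 * n + 1)"
    unfolding E2 ps(1) Q_def[symmetric] by (simp add: Q)
  have "e0 ^ 3 + e1 ^ 3 + e2 ^ 3 = (e0 + e1 + e2) ^ 3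
      - 3 * (e0 + e1 + e2) * (e0 * e1 + e1 * e2 + e2 * e0) + 3 * (e0 * e1 * e2)"
    by (simp add: power3_eq_cube algebra_simps)
  hence E3: "3 * (e0 * e1 * e2) = Q * t - N ^ 2 + 1 + 3 * N"
    unfolding ps(1,3) E2 by (simp add: algebra_simps)
  have A_eq: "of_int A = 9 * t + 8 - Q"
    unfolding t_def Q_def A_def
    by (simp only: of_int_add of_int_diff of_int_mult of_int_of_nat_eq of_int_numeral)
  have "y0 * y1 * y2 = 9 * (3 * (e0 * e1 * e2)) + 9 * (e0 * e1 + e1 * e2 + e2 * e0) + 3 * (e0 + e1 + e2) + 1"
    by (simp add: y0_def y1_def y2_def algebra_simps)
  hence "y0 * y1 * y2 = Q * of_int A"
    unfolding E3 E2 ps(1) A_eq by (simp add: Q power2_eq_square algebra_simps)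
  thus y3: "y0 * y1 * y2 = of_nat (3 * n + 1) * of_int A" unfolding Q_def .
  define D where "D = (y0 - y1) * (y1 - y2) * (y2 - y0)"
  have "D = 27 * ((e0 * e1 ^ 2 + e1 * e2 ^ 2 + e2 * e0 ^ 2) - (e0 ^ 2 * e1 + e1 ^ 2 * e2 + e2 ^ 2 * e0))"
    by (simp add: D_def y0_def y1_def y2_def power2_eq_square algebra_simps)
  hence D1: "D = - (27 * Q * of_int B)" unfolding ps(4,5) by (simp add: B_def algebra_simps)
  have y2': "y2 = - (y0 + y1)" using minus_unique[OF y1] by simp
  have "D ^ 2 = - 4 * (y0 * y1 + y1 * y2 + y2 * y0) ^ 3 - 27 * (y0 * y1 * y2) ^ 2"
    unfolding D_def y2' by (simp add: power2_eq_square power3_eq_cube algebra_simps)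
  also have "\<dots> = - 4 * (- 3 * Q) ^ 3 - 27 * (Q * of_int A) ^ 2"
    unfolding y2 y3 Q_def ..
  also have "\<dots> = 27 * Q ^ 2 * (4 * Q - of_int A ^ 2)"
    by (simp add: power2_eq_square power3_eq_cube algebra_simps)
  finally have "27 * Q ^ 2 * (4 * Q - of_int A ^ 2) = 27 * Q ^ 2 * (27 * of_int B ^ 2)"
    unfolding D1 by (simp add: power2_eq_square algebra_simps)
  hence "4 * Q - of_int A ^ 2 = 27 * of_int B ^ 2" using Q0 by (simp only: mult_cancel_left) simp
  hence "of_int (4 * int (3 * n + 1)) = (of_int (A ^ 2 + 27 * B ^ 2) :: complex)"
    by (simp add: Q_def algebra_simps)
  thus "4 * int (3 * n + 1) = A ^ 2 + 27 * B ^ 2" by (simp only: of_int_eq_iff)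
qed

text \<open>
  Counting in the field itself: $f(x) = 1 + x^n + x^{2n}$ is 3 on cubes, 0 on the other nonzero elements and 1 at 0,
  so $\sum_x f(x)f(1+x) = 9\,\mathrm{sol}(1,1,1) + 6$. Expanding, the power sums over the field leave only the
  monomials whose degree is a positive multiple of $3n$.
\<close>
lemma of_int_A: "(of_int A :: 'a) = - of_nat ((2 * n) choose n)"
proof -
  define f where "f x = 1 + x ^ n + x ^ (2 * n)" for x :: 'a
  define S where "S = {x. x \<in> R \<and> 1 + x \<in> R}"
  have f_R: "f x = 3" if "x \<in> R" for x
    using that by (simp add: f_def R_def power_mult mult.commute[of 2])
  have f_0: "f 0 = 1" using n_pos by (simp add: f_def power_0_left)
  have f_other: "f x = 0" if "x \<noteq> 0" "x \<notin> R" for x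
  proof -
    have "f x = 1 + x ^ n + (x ^ n) ^ 2" by (simp add: f_def power_mult mult.commute[of 2])
    moreover have "1 + (g ^ n) ^ 2 + ((g ^ n) ^ 2) ^ 2 = 1 + g ^ n * (g ^ n) ^ 3 + (g ^ n) ^ 2"
      by (simp add: power2_eq_square power3_eq_cube algebra_simps)
    ultimately show ?thesis
      using power_n_cases[OF that(1)] that(2) cube_root_of_unity by (auto simp: R_def)
  qed
  have "(\<Sum>x\<in>UNIV. f x * f (1 + x)) = (\<Sum>x\<in>insert 0 (insert (- 1) S). f x * f (1 + x))"
  proof (rule sum.mono_neutral_right)
    show "\<forall>x\<in>UNIV - insert 0 (insert (- 1) S). f x * f (1 + x) = 0"
    proof
      fix x assume "x \<in> UNIV - insert 0 (insert (- 1) S)"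
      hence "x \<noteq> 0" "1 + x \<noteq> 0" "x \<notin> R \<or> 1 + x \<notin> R" by (auto simp: S_def add_eq_0_iff)
      thus "f x * f (1 + x) = 0" using f_other by auto
    qed
  qed auto
  also have "\<dots> = f 0 * f 1 + (f (- 1) * f 0 + (\<Sum>x\<in>S. f x * f (1 + x)))"
  proof -
    have "0 \<notin> insert (- 1) S" "- 1 \<notin> S" using zero_notin_R by (auto simp: S_def)
    thus ?thesis by simp
  qed
  also have "(\<Sum>x\<in>S. f x * f (1 + x)) = (\<Sum>x\<in>S. 9)"
    by (intro sum.cong) (auto simp: S_def f_R)
  also have "card S = sol 1 1 1"
    unfolding sol_def
  proof (rule bij_betw_same_card)
    have neg: "- 1 - r \<in> R \<longleftrightarrow> 1 + r \<in> R" for r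
    proof -
      have "- 1 - r = - (1 + r)" by simp
      thus ?thesis by (simp only: uminus_in_R_iff)
    qed
    have eq: "1 * r + 1 * s + 1 = 0 \<longleftrightarrow> s = - 1 - r" for r s :: 'a
      using eq_neg_iff_add_eq_0[of s "1 + r"] by (simp add: algebra_simps)
    show "bij_betw (\<lambda>r. (r, - 1 - r)) S {(r, s). r \<in> R \<and> s \<in> R \<and> 1 * r + 1 * s + 1 = 0}"
      unfolding eq
      by (rule bij_betw_byWitness[where f' = fst])
        (auto simp: S_def neg)
  qed
  hence "(\<Sum>x\<in>S. 9) = (9 * of_nat (sol 1 1 1) :: 'a)" by simp
  finally have count: "(\<Sum>x\<in>UNIV. f x * f (1 + x)) = 6 + 9 * of_nat (sol 1 1 1)"
    using f_0 f_R[OF one_in_R] f_R[OF minus_one_in_R] by simp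

  define h where "h i j = (\<Sum>x\<in>UNIV. x ^ i * (1 + x) ^ j :: 'a)" for i j
  have h_eq: "h i j = (\<Sum>k\<le>j. of_nat (j choose k) * (if i + k > 0 \<and> 3 * n dvd i + k then - 1 else 0))"
    for i j
  proof -
    have "h i j = (\<Sum>x\<in>UNIV. \<Sum>k\<le>j. of_nat (j choose k) * x ^ (i + k))"
      unfolding h_def by (subst add.commute[of 1])
        (simp add: binomial_ring sum_distrib_left power_add mult_ac)
    also have "\<dots> = (\<Sum>k\<le>j. of_nat (j choose k) * (\<Sum>x\<in>UNIV. x ^ (i + k)))"
      by (subst sum.swap) (simp add: sum_distrib_left)
    finally show ?thesis by (simp only: sum_powers_eq card add_diff_cancel_right')
  qed
  have h_single: "h i j = - of_nat (j choose k)"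
    if "k \<le> j" "i + k = 3 * n" "i + j < 6 * n" for i j k
  proof -
    have *: "(i + l > 0 \<and> 3 * n dvd i + l) \<longleftrightarrow> l = k" if "l \<le> j" for l
    proof
      assume il: "i + l > 0 \<and> 3 * n dvd i + l"
      then obtain z where z: "i + l = 3 * n * z" by (auto elim: dvdE)
      have "z \<noteq> 0" using il z by (intro notI) simp
      moreover have "3 * n * z < 3 * n * 2" using z that \<open>i + j < 6 * n\<close> by linarith
      hence "z < 2" by simp
      ultimately have "z = 1" by simp
      thus "l = k" using z \<open>i + k = 3 * n\<close> by simp
    qed (use \<open>i + k = 3 * n\<close> n_pos in auto)
    have "h i j = (\<Sum>l\<le>j. if l = k then - of_nat (j choose k) else 0)"
      unfolding h_eq by (intro sum.cong) (use * in auto)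
    thus ?thesis using that(1) by simp
  qed
  have h_zero: "h i j = 0" if "i + j < 3 * n" for i j
  proof -
    have "\<not> (i + l > 0 \<and> 3 * n dvd i + l)" if "l \<le> j" for l
      using that \<open>i + j < 3 * n\<close> by (auto dest: dvd_imp_le)
    thus ?thesis unfolding h_eq by (intro sum.neutral) auto
  qed
  have "(\<Sum>x\<in>UNIV. f x * f (1 + x)) = h 0 0 + h 0 n + h 0 (2 * n) + h n 0 + h n n + h n (2 * n)
      + h (2 * n) 0 + h (2 * n) n + h (2 * n) (2 * n)"
    unfolding h_def f_def sum.distrib[symmetric] by (intro sum.cong) (auto simp: algebra_simps)
  also have "\<dots> = - 2 - of_nat ((2 * n) choose n)"
    using h_zero[of 0 0] h_zero[of 0 n] h_zero[of 0 "2 * n"] h_zero[of n 0] h_zero[of n n] h_zero[of "2 * n" 0]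
      h_single[of "2 * n" "2 * n" n] h_single[of n n "2 * n"] h_single[of n "2 * n" "2 * n"] n_pos by simp
  finally have eq: "6 + 9 * of_nat (sol 1 1 1) = - 2 - (of_nat ((2 * n) choose n) :: 'a)"
    unfolding count .
  have "(9 * of_nat (sol 1 1 1) + 8 :: 'a) = (6 + 9 * of_nat (sol 1 1 1)) + 2" by simp
  also have "\<dots> = - of_nat ((2 * n) choose n)" unfolding eq by simp
  finally have "(9 * of_nat (sol 1 1 1) + 8 :: 'a) = - of_nat ((2 * n) choose n)" .
  moreover have "(of_nat (3 * n + 1) :: 'a) = 0"
    using of_nat_CARD_eq_0[where 'a = 'a] unfolding card .
  moreover have "(of_int A :: 'a) = 9 * of_nat (sol 1 1 1) + 8 - of_nat (3 * n + 1)"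
    unfolding A_def by simp
  ultimately show ?thesis by simp
qed

end

section \<open>Spectrum, symmetry and connectedness of the cubic Paley graph\<close>

context cubic_periods
begin

lemma spectrum_periods:
  "graph_spectrum (gen_paley 3 :: 'a pair_pre_digraph) =
    replicate_mset 1 (of_nat n) + replicate_mset n e0 + replicate_mset n e1 + replicate_mset n e2"
proof -
  have rep: "(\<Sum>r\<in>R. {#x#}) = replicate_mset n x" for x :: complex
  proof -
    have "(\<Sum>r\<in>T. {#x#}) = replicate_mset (card T) x" if "finite T" for T :: "'a set"
      using that by induction auto
    thus ?thesis using card_R by simp
  qed
  have "graph_spectrum (gen_paley 3 :: 'a pair_pre_digraph) = (\<Sum>c\<in>UNIV. {#period c#})"
    using graph_spectrum_gen_paley_character[of \<psi> 3] add orthogonality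
    by (simp add: card power_residues_3 period_def)
  also have "\<dots> = {#period 0#} + (\<Sum>c\<in>UNIV - {0}. {#period c#})" by (rule sum.remove) auto
  also have "(\<Sum>c\<in>UNIV - {0}. {#period c#}) = (\<Sum>r\<in>R. {#period 1#}) + (\<Sum>r\<in>R. {#period g#}) + (\<Sum>r\<in>R. {#period (g ^ 2)#})"
    by (rule sum_nonzero_by_cosets) (simp add: period_mult_R)
  finally show ?thesis unfolding rep by (simp add: period_0 e0_def e1_def e2_def)
qed

text \<open>
  Such a set \<open>S\<close> is an additive subgroup consisting of 0 and of whole cosets of the cubes, hence has $1 + nj$
  elements with $j \ge 1$. Two disjoint translates force $j = 1$, and then there is room for a third one, which
  contradicts $3(n+1) > 3n+1$. For $n = 1$ the statement fails in the field with four elements.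
\<close>
lemma R_invariant_additive_closed_eq_UNIV:
  assumes n2: "n \<ge> 2" and zero: "0 \<in> S" and one: "1 \<in> S"
    and sum: "\<And>x y. x \<in> S \<Longrightarrow> y \<in> S \<Longrightarrow> x + y \<in> S"
    and mult: "\<And>x r. x \<in> S \<Longrightarrow> r \<in> R \<Longrightarrow> x * r \<in> S"
  shows "S = UNIV"
proof (rule ccontr)
  assume proper: "S \<noteq> UNIV"
  have diff: "x - y \<in> S" if "x \<in> S" "y \<in> S" for x y
    using sum[OF that(1) mult[OF that(2) minus_one_in_R]] by simp
  have inv: "(x * r \<in> S) = (x \<in> S)" if "r \<in> R" for x r
  proof
    assume "x * r \<in> S"
    hence "x * r * (1 / r) \<in> S" using divide_in_R[OF one_in_R that] by (rule mult)
    moreover have "r \<noteq> 0" using that zero_notin_R by blast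
    ultimately show "x \<in> S" by simp
  qed (use mult that in auto)
  obtain j :: nat where j: "card S = 1 + n * j" "j \<ge> 1"
  proof
    have "card (S - {0}) = (\<Sum>x\<in>UNIV - {0}. if x \<in> S then 1 else 0)"
      by (simp add: sum.If_cases Int_commute Diff_eq)
    also have "\<dots> = (\<Sum>r\<in>R. if 1 \<in> S then 1 else 0) + (\<Sum>r\<in>R. if g \<in> S then 1 else 0)
        + (\<Sum>r\<in>R. if g ^ 2 \<in> S then 1 else 0)"
      by (rule sum_nonzero_by_cosets) (simp add: inv)
    also have "\<dots> = n * (1 + (if g \<in> S then 1 else 0) + (if g ^ 2 \<in> S then 1 else 0))"
      using one by (simp add: card_R)
    finally show "card S = 1 + n * (1 + (if g \<in> S then 1 else 0) + (if g ^ 2 \<in> S then 1 else 0))"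
      using card.remove[OF finite zero] by simp
  qed auto
  define co where "co x = (\<lambda>s. x + s) ` S" for x
  have card_co: "card (co x) = card S" for x unfolding co_def by (rule card_image) simp
  have disj: "S \<inter> co x = {}" if "x \<notin> S" for x
    using that diff[of "x + _"] by (auto simp: co_def) (metis add_diff_cancel_right' diff)
  have card_UN: "card T \<le> 3 * n + 1" for T :: "'a set"
    using card_mono[of UNIV T] card by simp
  obtain x where x: "x \<notin> S" using proper by blast
  have c2: "card (S \<union> co x) = 2 * card S"
    using disj[OF x] by (subst card_Un_disjoint) (auto simp: card_co)
  hence "2 * (1 + n * j) \<le> 3 * n + 1" using card_UN[of "S \<union> co x"] j(1) by simp
  hence "2 * 1 + 2 * (n * j) \<le> 3 * n + 1" by (simp only: distrib_left)
  hence "n * j < n * 2" using n2 by linarith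
  hence "j = 1" using j(2) by simp
  hence cS: "card S = 1 + n" using j(1) by simp
  hence "card (S \<union> co x) < CARD('a)" using c2 card n2 by simp
  hence "S \<union> co x \<noteq> UNIV" by auto
  then obtain y where y: "y \<notin> S" "y \<notin> co x" by blast
  have "co x \<inter> co y = {}"
  proof (rule ccontr)
    assume "\<not> ?thesis"
    then obtain s t where st: "s \<in> S" "t \<in> S" "x + s = y + t" by (auto simp: co_def)
    have "y = x + (s - t)" using st(3) by (simp add: algebra_simps eq_diff_eq)
    thus False using y(2) diff[OF st(1,2)] by (auto simp: co_def)
  qed
  hence "card (S \<union> co x \<union> co y) = 3 * card S"
    using c2 disj[OF y(1)] by (subst card_Un_disjoint) (auto simp: card_co)
  thus False using card_UN[of "S \<union> co x \<union> co y"] cS by simp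
qed

lemma parcs_gen_paley_3: "parcs (gen_paley 3 :: 'a pair_pre_digraph) = {(u, v). v - u \<in> R}"
  by (simp add: gen_paley_def power_residues_3)

lemma symmetric_gen_paley_3: "symmetric (with_proj (gen_paley 3 :: 'a pair_pre_digraph))"
proof -
  have "u - v \<in> R" if "v - u \<in> R" for u v using uminus_in_R[OF that] by simp
  thus ?thesis by (auto simp: symmetric_def sym_def parcs_gen_paley_3)
qed

lemma connected_gen_paley_3:
  assumes "n \<ge> 2"
  shows "Digraph_Component.connected (with_proj (gen_paley 3 :: 'a pair_pre_digraph))"
proof -
  define G where "G = mk_symmetric (with_proj (gen_paley 3 :: 'a pair_pre_digraph))"
  define T where "T = rtrancl_on UNIV (parcs G)"
  have arc: "(u, u + r) \<in> parcs G" if "r \<in> R" for u r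
    unfolding G_def parcs_mk_symmetric using that
    by (intro UN_I[of "(u, u + r)"]) (simp_all add: parcs_gen_paley_3)
  \<comment> \<open>Quantifying over the multiplier \<open>r\<close> makes invariance under multiplication by cubes immediate.\<close>
  define S where "S = {x. \<forall>r\<in>R. \<forall>u. (u, u + x * r) \<in> T}"
  have "S = UNIV"
  proof (rule R_invariant_additive_closed_eq_UNIV[OF assms])
    show "0 \<in> S" by (simp add: S_def T_def)
    show "1 \<in> S" using arc by (auto simp: S_def T_def intro: rtrancl_on_into_rtrancl_on)
    show "x + y \<in> S" if "x \<in> S" "y \<in> S" for x y
      unfolding S_def
    proof (clarify)
      fix r u assume "r \<in> R"
      hence "(u, u + x * r) \<in> T" "(u + x * r, u + x * r + y * r) \<in> T" using that by (auto simp: S_def)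
      hence "(u, u + x * r + y * r) \<in> T" unfolding T_def by (rule rtrancl_on_trans)
      thus "(u, u + (x + y) * r) \<in> T" by (simp add: algebra_simps)
    qed
    show "x * r \<in> S" if "x \<in> S" "r \<in> R" for x r
      using that by (auto simp: S_def mult.assoc mult_in_R)
  qed
  have "(u, v) \<in> T" for u v
  proof -
    have "v - u \<in> S" using \<open>S = UNIV\<close> by simp
    hence "(u, u + (v - u) * 1) \<in> T" using one_in_R unfolding S_def by blast
    thus ?thesis by simp
  qed
  moreover have "pverts G = UNIV" by (simp add: G_def gen_paley_def)
  ultimately show ?thesis
    unfolding Digraph_Component.connected_def G_def[symmetric]
    by (intro strongly_connectedI) (auto simp: reachable_def T_def)
qed

end

lemma exists_cubic_periods:
  fixes p m n :: nat
  assumes "prime p" "CARD('a::{field,finite}) = p ^ m" "CARD('a) = 3 * n + 1" "n > 0"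
  obtains \<psi> :: "'a::{field,finite} \<Rightarrow> complex" and g where "cubic_periods \<psi> n g"
proof -
  obtain \<psi> :: "'a \<Rightarrow> complex" where psi: "\<And>x y. \<psi> (x + y) = \<psi> x * \<psi> y" "\<And>x. norm (\<psi> x) = 1" "\<exists>x. \<psi> x \<noteq> 1"
    using exists_nontrivial_additive_character[OF assms(1,2)] by blast
  have "card {x::'a. x ^ n = 1} \<le> n" using assms(4) by (rule card_nth_roots_le)
  hence "card {x::'a. x ^ n = 1} < card (UNIV - {0::'a})" using assms(3,4) by (simp add: card_Diff_singleton)
  hence "\<not> UNIV - {0} \<subseteq> {x::'a. x ^ n = 1}" using card_mono[of "{x::'a. x ^ n = 1}" "UNIV - {0}"] by auto
  then obtain g :: 'a where "g \<noteq> 0" "g ^ n \<noteq> 1" by blast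
  hence "cubic_periods \<psi> n g" using psi assms(3,4) by unfold_locales auto
  thus ?thesis by (rule that)
qed

text \<open>
  The spectrum in terms of the cubic $y^3 - 3qy - qA$: any three numbers with the elementary symmetric functions
  $0$, $-3q$, $qA$ give the nontrivial eigenvalues $(y - 1)/3$.
\<close>
lemma spectrum_gen_paley_3:
  fixes p m n :: nat
  assumes p: "prime p" and card_q: "CARD('a::{field,finite}) = p ^ m" and n: "p ^ m = 3 * n + 1" "n > 0"
  obtains A B :: int
  where "4 * int (p ^ m) = A ^ 2 + 27 * B ^ 2" "[A = 1] (mod 3)"
    "[p = 1] (mod 3) \<Longrightarrow> coprime A (int p)"
    "set_mset (graph_spectrum (gen_paley 3 :: 'a::{field,finite} pair_pre_digraph)) \<subseteq> \<real>"
    "\<And>y0 y1 y2 :: complex. y0 + y1 + y2 = 0 \<Longrightarrow> y0 * y1 + y1 * y2 + y2 * y0 = - 3 * of_nat (p ^ m) \<Longrightarrow>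
       y0 * y1 * y2 = of_nat (p ^ m) * of_int A \<Longrightarrow>
       graph_spectrum (gen_paley 3 :: 'a pair_pre_digraph) = replicate_mset 1 (of_nat n)
         + replicate_mset n ((y0 - 1) / 3) + replicate_mset n ((y1 - 1) / 3) + replicate_mset n ((y2 - 1) / 3)"
proof -
  obtain \<psi> :: "'a \<Rightarrow> complex" and g where "cubic_periods \<psi> n g"
    using exists_cubic_periods[OF p card_q] card_q n by auto
  then interpret cubic_periods \<psi> n g .
  show ?thesis
  proof (rule that)
    show "4 * int (p ^ m) = A ^ 2 + 27 * B ^ 2" using period_polynomial(4) unfolding n(1) .
    show "[A = 1] (mod 3)" by (rule A_cong_1)
    show "coprime A (int p)" if "[p = 1] (mod 3)"
    proof -
      have char: "CHAR('a) = p" by (rule CHAR_eq_of_card_prime_power[OF p card_q])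
      have "(p ^ m - 1) div 3 = n" using n by simp
      hence "(of_nat ((2 * n) choose n) :: 'a) \<noteq> 0"
        using central_binomial_third_nonzero[OF char p that, of m] by simp
      hence "(of_int A :: 'a) \<noteq> 0" by (simp add: of_int_A)
      hence "\<not> int p dvd A" by (simp add: of_int_eq_0_iff_char_dvd char)
      thus ?thesis using p by (metis coprime_commute prime_imp_coprime prime_nat_int_transfer)
    qed
    show "set_mset (graph_spectrum (gen_paley 3 :: 'a pair_pre_digraph)) \<subseteq> \<real>"
      unfolding spectrum_periods using period_real by (auto simp: e0_def e1_def e2_def split: if_splits)
  next
    fix y0 y1 y2 :: complex
    assume y: "y0 + y1 + y2 = 0" "y0 * y1 + y1 * y2 + y2 * y0 = - 3 * of_nat (p ^ m)"
      "y0 * y1 * y2 = of_nat (p ^ m) * of_int A"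
    have "{#3 * e0 + 1, 3 * e1 + 1, 3 * e2 + 1#} = {#y0, y1, y2#}"
      by (rule mset3_eqI) (use y period_polynomial in \<open>simp_all only: n(1)\<close>)
    hence "image_mset (\<lambda>y. (y - 1) / 3) {#3 * e0 + 1, 3 * e1 + 1, 3 * e2 + 1#}
        = image_mset (\<lambda>y. (y - 1) / 3) {#y0, y1, y2#}" by simp
    hence "repeat_mset n {#e0, e1, e2#} = repeat_mset n {#(y0 - 1) / 3, (y1 - 1) / 3, (y2 - 1) / 3#}"
      by simp
    moreover have "repeat_mset n {#a, b, c#} = replicate_mset n a + replicate_mset n b + replicate_mset n c"
      for a b c :: complex by (rule multiset_eqI) simp
    ultimately show "graph_spectrum (gen_paley 3 :: 'a pair_pre_digraph) = replicate_mset 1 (of_nat n)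
         + replicate_mset n ((y0 - 1) / 3) + replicate_mset n ((y1 - 1) / 3) + replicate_mset n ((y2 - 1) / 3)"
      unfolding spectrum_periods by (simp add: add.assoc)
  qed
qed

section \<open>The eigenvalues in the three cases\<close>

text \<open>
  Cardano's parametrisation: the three numbers $-(\omega^j u + \omega^{-j} v)$ are the roots of
  $y^3 - 3uv\,y + u^3 + v^3$. The inverse of $\omega^j$ is written as $\omega^{2j}$.
\<close>
lemma sum_conjugate_cubic_roots:
  fixes u v w :: complex
  assumes w: "1 + w + w ^ 2 = 0" "w ^ 3 = 1"
  defines "y \<equiv> \<lambda>j::nat. - (w ^ j * u + w ^ (2 * j) * v)"
  shows "y 0 + y 1 + y 2 = 0"
    and "y 0 * y 1 + y 1 * y 2 + y 2 * y 0 = - 3 * (u * v)"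
    and "y 0 * y 1 * y 2 = - (u ^ 3 + v ^ 3)"
proof -
  have w2: "w ^ 2 = - 1 - w"
    using w(1) eq_neg_iff_add_eq_0[of "w ^ 2" "1 + w"] by (simp add: add.commute)
  have w4: "w ^ 4 = w" using w(2) by (simp add: eval_nat_numeral)
  have y: "y 0 = - (u + v)" "y 1 = - (w * u + (- 1 - w) * v)" "y 2 = - ((- 1 - w) * u + w * v)"
    by (simp_all add: y_def w2 w4)
  have ww: "w * w = - 1 - w" using w2 by (simp add: power2_eq_square)
  have www: "w * (w * x) = - x - w * x" for x
    using arg_cong[OF ww, of "\<lambda>z. z * x"] by (simp add: algebra_simps)
  show "y 0 + y 1 + y 2 = 0" unfolding y by (simp add: algebra_simps)
  show "y 0 * y 1 + y 1 * y 2 + y 2 * y 0 = - 3 * (u * v)"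
    unfolding y by (simp add: algebra_simps ww www)
  show "y 0 * y 1 * y 2 = - (u ^ 3 + v ^ 3)"
    unfolding y by (simp add: power3_eq_cube algebra_simps ww www)
qed

lemma exp_third_root_of_unity:
  defines "w \<equiv> exp (2 * of_real pi * \<i> / 3 :: complex)"
  shows "w ^ 3 = 1" "1 + w + w ^ 2 = 0"
proof -
  have "w ^ 3 = exp (of_nat 3 * (2 * of_real pi * \<i> / 3))" unfolding w_def by (rule exp_of_nat_mult[symmetric])
  also have "\<dots> = exp (2 * of_real pi * \<i>)" by (rule arg_cong[of _ _ exp]) simp
  also have "\<dots> = 1" by (rule exp_two_pi_i)
  finally show 1: "w ^ 3 = 1" .
  have "w \<noteq> 1" using complex_root_unity_eq_1[of 3 1] by (simp add: w_def)
  moreover have "(w - 1) * (1 + w + w ^ 2) = w ^ 3 - 1"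
    by (simp add: power2_eq_square power3_eq_cube algebra_simps)
  ultimately show "1 + w + w ^ 2 = 0" using 1 by simp
qed

lemma minus_1_div_3_in_Ints:
  fixes z :: int
  assumes "[z = 1] (mod 3)"
  shows "(of_real ((of_int z - 1) / 3) :: complex) \<in> \<int>"
proof -
  obtain k where "z - 1 = 3 * k" using assms by (auto simp: cong_iff_dvd_diff)
  hence "z = 3 * k + 1" by simp
  hence "(of_real ((of_int z - 1) / 3) :: complex) = of_int k" by simp
  thus ?thesis by simp
qed

text \<open>
  If $(a + 3b\sqrt{-3})/2$ has norm \<open>r\<close>, its cube has norm $r^3$ and trace $a^3 - 3ar$.
\<close>
lemma cubic_rep_cube:
  fixes p r :: nat
  assumes ab: "cubic_rep p (real r) a b" and dvd: "p dvd r"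
  shows "cubic_rep p (real (r ^ 3)) (a ^ 3 - 3 * a * int r) (b * (a ^ 2 - int r))"
proof -
  define R where "R = int r"
  have 1: "4 * R = a ^ 2 + 27 * b ^ 2" "[a = 1] (mod 3)" "coprime a (int p)"
    using ab unfolding cubic_rep_int_iff R_def by auto
  have b2: "27 * b ^ 2 = 4 * R - a ^ 2" using 1(1) by simp
  have "(a ^ 3 - 3 * a * R) ^ 2 + 27 * (b * (a ^ 2 - R)) ^ 2
      = (a ^ 3 - 3 * a * R) ^ 2 + (27 * b ^ 2) * (a ^ 2 - R) ^ 2" by (simp add: power_mult_distrib)
  also have "\<dots> = 4 * R ^ 3"
    unfolding b2 by (simp add: power2_eq_square power3_eq_cube algebra_simps)
  finally have "4 * int (r ^ 3) = (a ^ 3 - 3 * a * R) ^ 2 + 27 * (b * (a ^ 2 - R)) ^ 2"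
    by (simp add: R_def)
  moreover have "[a ^ 3 - 3 * a * R = 1] (mod 3)"
  proof -
    have "[a ^ 3 - 3 * (a * R) = 1 ^ 3 - 0] (mod 3)"
      using 1(2) by (intro cong_diff cong_pow) (simp_all add: cong_def)
    thus ?thesis by (simp add: mult.assoc)
  qed
  moreover have "coprime (a ^ 3 - 3 * a * R) (int p)"
  proof -
    have "int p dvd R" using dvd by (simp add: R_def)
    hence "[a ^ 2 = a ^ 2 - 3 * R] (mod int p)" by (simp add: cong_iff_dvd_diff)
    hence "coprime (a ^ 2 - 3 * R) (int p)" using 1(3) by (elim cong_imp_coprime) simp
    hence "coprime (a * (a ^ 2 - 3 * R)) (int p)" using 1(3) by simp
    thus ?thesis by (simp add: power2_eq_square power3_eq_cube algebra_simps)
  qed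
  ultimately show ?thesis unfolding cubic_rep_int_iff R_def by blast
qed

lemma root_3_prime_power: "root 3 (real (p ^ (3 * k))) = real (p ^ k)"
proof -
  have "real (p ^ (3 * k)) = real (p ^ k) ^ 3" by (simp add: mult.commute flip: power_mult)
  thus ?thesis by (simp add: real_root_power_cancel)
qed

lemma power_eq_1_mod_3_cong:
  assumes "[p = 2] (mod 3)"
  shows "even k \<Longrightarrow> [p ^ k = 1] (mod (3::nat))" and "odd k \<Longrightarrow> [p ^ k = 2] (mod (3::nat))"
proof -
  have ev: "[p ^ (2 * j) = 1] (mod 3)" for j
  proof -
    have "[(p ^ 2) ^ j = (2 ^ 2) ^ j] (mod 3)" using assms by (intro cong_pow)
    moreover have "[(2 ^ 2) ^ j = 1 ^ j] (mod (3::nat))" by (rule cong_pow) (simp add: cong_def)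
    ultimately show ?thesis by (simp add: power_mult cong_trans)
  qed
  thus "even k \<Longrightarrow> [p ^ k = 1] (mod 3)" by (auto elim: evenE)
  have "[p ^ (2 * j) * p = 1 * 2] (mod 3)" for j using ev assms by (rule cong_mult)
  thus "odd k \<Longrightarrow> [p ^ k = 2] (mod 3)" by (auto elim!: oddE simp: mult.commute)
qed

theorem theorem3p1:
  fixes \<Gamma> :: "'a::{field,finite} pair_pre_digraph"
    and p m q n :: nat
  assumes "prime p"
    and "q = p ^ m"
    and "CARD('a) = q"
    and "q \<ge> 5"
    and "3 dvd q - 1"
    and "n = (q - 1) div 3"
    and "\<Gamma> = gen_paley 3"
  shows "Digraph_Component.connected (with_proj \<Gamma>) \<and>
    symmetric (with_proj \<Gamma>) \<and>
    set_mset (graph_spectrum \<Gamma>) \<subseteq> \<real> \<and>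
    \<comment> \<open>(a)\<close>
    ([p = 1] (mod 3) \<and> 3 dvd m \<longrightarrow>
       unique_up_to_sign (cubic_rep p (root 3 (real q))) \<and>
       (\<forall>a b. cubic_rep p (root 3 (real q)) a b \<longrightarrow>
          graph_spectrum \<Gamma> =
            replicate_mset 1 (of_nat n)
            + replicate_mset n (of_real ((of_int a * root 3 (real q) - 1) / 3))
            + replicate_mset n
                (of_real ((- (1 / 2) * (of_int a + 9 * of_int b) * root 3 (real q) - 1) / 3))
            + replicate_mset n
                (of_real ((- (1 / 2) * (of_int a - 9 * of_int b) * root 3 (real q) - 1) / 3))) \<and>
       set_mset (graph_spectrum \<Gamma>) \<subseteq> \<int>) \<and>
    \<comment> \<open>(b)\<close>
    ([p = 1] (mod 3) \<and> \<not> 3 dvd m \<longrightarrow>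
       unique_up_to_sign (cubic_rep p (real q)) \<and>
       (\<forall>a b. cubic_rep p (real q) a b \<longrightarrow>
          (\<forall>s c d :: complex.
             s ^ 2 = - 27 \<longrightarrow> c ^ 3 = of_nat q \<longrightarrow>
             d ^ 3 = (1 / 2) * (- of_int a + s * of_int b) \<longrightarrow>
             (let W = c * d;
                  \<omega> = exp (2 * of_real pi * \<i> / 3);
                  x = (\<lambda>j::nat. - (1 / 3) * (1 + \<omega> ^ j * W + of_nat q / (\<omega> ^ j * W)))
              in graph_spectrum \<Gamma> =
                   replicate_mset 1 (of_nat n)
                   + replicate_mset n (x 0) + replicate_mset n (x 1)
                   + replicate_mset n (x 2))))) \<and>
    \<comment> \<open>(c)\<close>
    ([p = 2] (mod 3) \<and> even m \<longrightarrow>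
       ([m = 0] (mod 4) \<longrightarrow>
          graph_spectrum \<Gamma> =
            replicate_mset 1 (of_nat n)
            + replicate_mset (2 * n) (of_real ((sqrt (real q) - 1) / 3))
            + replicate_mset n (of_real ((- 2 * sqrt (real q) - 1) / 3))) \<and>
       ([m = 2] (mod 4) \<longrightarrow>
          graph_spectrum \<Gamma> =
            replicate_mset 1 (of_nat n)
            + replicate_mset n (of_real ((2 * sqrt (real q) - 1) / 3))
            + replicate_mset (2 * n) (of_real ((- sqrt (real q) - 1) / 3))) \<and>
       set_mset (graph_spectrum \<Gamma>) \<subseteq> \<int>)"
proof -
  have p: "prime p" and q: "q = p ^ m" and card_q: "CARD('a) = p ^ m" and q5: "q \<ge> 5"
    and G: "\<Gamma> = gen_paley 3" using assms by auto
  have qn: "p ^ m = 3 * n + 1" using assms(4,5,6) q by auto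
  have n: "n > 0" "n \<ge> 2" using qn q q5 by auto
  have m: "m \<ge> 1" using q q5 by (cases m) auto
  obtain \<psi> :: "'a \<Rightarrow> complex" and g where "cubic_periods \<psi> n g"
    using exists_cubic_periods[OF p card_q] card_q qn n by auto
  then interpret cubic_periods \<psi> n g .
  obtain A B where AB: "4 * int (p ^ m) = A ^ 2 + 27 * B ^ 2" "[A = 1] (mod 3)"
    "[p = 1] (mod 3) \<Longrightarrow> coprime A (int p)"
    and real: "set_mset (graph_spectrum \<Gamma>) \<subseteq> \<real>"
    and spec: "\<And>y0 y1 y2 :: complex. y0 + y1 + y2 = 0 \<Longrightarrow>
       y0 * y1 + y1 * y2 + y2 * y0 = - 3 * of_nat q \<Longrightarrow> y0 * y1 * y2 = of_nat q * of_int A \<Longrightarrow>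
       graph_spectrum \<Gamma> = replicate_mset 1 (of_nat n)
         + replicate_mset n ((y0 - 1) / 3) + replicate_mset n ((y1 - 1) / 3) + replicate_mset n ((y2 - 1) / 3)"
    using spectrum_gen_paley_3[OF p card_q qn n(1)] unfolding G q by blast
  have case_a: "unique_up_to_sign (cubic_rep p (root 3 (real q))) \<and>
       (\<forall>a b. cubic_rep p (root 3 (real q)) a b \<longrightarrow>
          graph_spectrum \<Gamma> =
            replicate_mset 1 (of_nat n)
            + replicate_mset n (of_real ((of_int a * root 3 (real q) - 1) / 3))
            + replicate_mset n
                (of_real ((- (1 / 2) * (of_int a + 9 * of_int b) * root 3 (real q) - 1) / 3))
            + replicate_mset n
                (of_real ((- (1 / 2) * (of_int a - 9 * of_int b) * root 3 (real q) - 1) / 3))) \<and>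
       set_mset (graph_spectrum \<Gamma>) \<subseteq> \<int>"
    if p1: "[p = 1] (mod 3)" and "3 dvd m"
  proof -
    obtain k where mk: "m = 3 * k" using \<open>3 dvd m\<close> by blast
    have k: "k \<ge> 1" using m mk by simp
    define r where "r = p ^ k"
    have root: "root 3 (real q) = real r" unfolding q mk r_def by (rule root_3_prime_power)
    have qr: "p ^ m = r ^ 3" by (simp add: mk r_def mult.commute flip: power_mult)
    have uniq: "unique_up_to_sign (cubic_rep p (real r))"
      unfolding r_def by (rule cubic_rep_unique_up_to_sign[OF p p1 k])
    have main: "graph_spectrum \<Gamma> = replicate_mset 1 (of_nat n)
            + replicate_mset n (of_real ((of_int a * real r - 1) / 3))
            + replicate_mset n (of_real ((- (1 / 2) * (of_int a + 9 * of_int b) * real r - 1) / 3))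
            + replicate_mset n (of_real ((- (1 / 2) * (of_int a - 9 * of_int b) * real r - 1) / 3))"
      if ab: "cubic_rep p (real r) a b" for a b
    proof -
      have "p dvd r" using k by (simp add: r_def)
      hence "cubic_rep p (real (p ^ m)) (a ^ 3 - 3 * a * int r) (b * (a ^ 2 - int r))"
        unfolding qr by (rule cubic_rep_cube[OF ab])
      moreover have "cubic_rep p (real (p ^ m)) A B" using AB p1 by (simp only: cubic_rep_int_iff)
      ultimately have A: "A = a ^ 3 - 3 * a * int r" using cubic_rep_unique[OF p p1 m] by blast
      \<comment> \<open>The cubic \<open>y\<^sup>3 - 3 r\<^sup>3 y - r\<^sup>3 A\<close> factors for this \<open>A\<close>.\<close>
      define y0 y1 y2 :: complex where y: "y0 = of_int a * of_nat r"
        "y1 = - (1 / 2) * (of_int a + 9 * of_int b) * of_nat r"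
        "y2 = - (1 / 2) * (of_int a - 9 * of_int b) * of_nat r"
      have "4 * int r = a ^ 2 + 27 * b ^ 2" using ab by (simp add: cubic_rep_int_iff)
      hence "of_int (4 * int r) = (of_int (a ^ 2 + 27 * b ^ 2) :: complex)" by (simp only:)
      hence R: "(4 * of_nat r :: complex) = of_int a ^ 2 + 27 * of_int b ^ 2" by simp
      have Q: "(of_nat q :: complex) = of_nat r ^ 3" by (simp add: q qr)
      have "y0 + y1 + y2 = 0" by (simp add: y field_simps)
      moreover have "y0 * y1 + y1 * y2 + y2 * y0 = - 3 * of_nat q"
      proof -
        have "y0 * y1 + y1 * y2 + y2 * y0 = - (3 / 4) * (of_int a ^ 2 + 27 * of_int b ^ 2) * of_nat r ^ 2"
          by (simp add: y field_simps power2_eq_square)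
        also have "\<dots> = - (3 / 4) * (4 * of_nat r) * of_nat r ^ 2" unfolding R ..
        finally show ?thesis by (simp add: Q power2_eq_square power3_eq_cube)
      qed
      moreover have "y0 * y1 * y2 = of_nat q * of_int A"
      proof -
        have "y0 * y1 * y2 = of_nat r ^ 3 * of_int a * (of_int a ^ 2 - 81 * of_int b ^ 2) / 4"
          by (simp add: y field_simps power2_eq_square power3_eq_cube)
        also have "of_int a ^ 2 - 81 * of_int b ^ 2 = 4 * of_int a ^ 2 - 3 * (of_int a ^ 2 + 27 * of_int b ^ 2 :: complex)"
          by simp
        also have "\<dots> = 4 * of_int a ^ 2 - 3 * (4 * of_nat r)" unfolding R ..
        also have "of_nat r ^ 3 * of_int a * (4 * of_int a ^ 2 - 3 * (4 * of_nat r)) / 4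
            = of_nat r ^ 3 * (of_int a ^ 3 - 3 * of_int a * of_nat r :: complex)"
          by (simp add: field_simps power2_eq_square power3_eq_cube)
        finally have "y0 * y1 * y2 = of_nat r ^ 3 * (of_int a ^ 3 - 3 * of_int a * of_nat r)" .
        thus ?thesis unfolding Q A by simp
      qed
      ultimately show ?thesis using spec[of y0 y1 y2] by (simp add: y)
    qed
    have "set_mset (graph_spectrum \<Gamma>) \<subseteq> \<int>"
    proof -
      obtain a b where ab: "cubic_rep p (real r) a b"
        using cubic_rep_prime_power_exists[OF p p1 k] unfolding r_def by blast
      have 1: "4 * int r = a ^ 2 + 27 * b ^ 2" "[a = 1] (mod 3)" using ab by (simp_all add: cubic_rep_int_iff)
      have "[r = 1 ^ k] (mod 3)" unfolding r_def using p1 by (rule cong_pow)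
      hence r1: "[int r = 1] (mod 3)" by (metis cong_int_iff of_nat_1 of_nat_numeral power_one)
      have int1: "(of_real ((of_int c * real r - 1) / 3) :: complex) \<in> \<int>" if "[c = 1] (mod 3)" for c
      proof -
        have "[c * int r = 1 * 1] (mod 3)" using that r1 by (rule cong_mult)
        from minus_1_div_3_in_Ints[OF this[unfolded mult_1]] show ?thesis by simp
      qed
      have int2: "(of_real ((- (1 / 2) * (of_int a + 9 * of_int d) * real r - 1) / 3) :: complex) \<in> \<int>"
        if "even (a - d)" for d
      proof -
        have "even (a + 9 * d)" using that by simp
        then obtain c where c: "a + 9 * d = 2 * c" by blast
        obtain e where e: "a - 1 = 3 * e" using 1(2) by (auto simp: cong_iff_dvd_diff)
        hence "- c - 1 = 3 * (e + 3 * d - c)" using c by simp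
        hence "[- c = 1] (mod 3)" by (simp only: cong_iff_dvd_diff dvd_triv_left)
        from int1[OF this] show ?thesis
        proof -
          have "real_of_int a + 9 * real_of_int d = real_of_int (a + 9 * d)" by simp
          also have "\<dots> = 2 * real_of_int c" unfolding c by simp
          finally have eq: "real_of_int a + 9 * real_of_int d = 2 * real_of_int c" .
          show ?thesis unfolding eq using \<open>_ \<in> \<int>\<close> by simp
        qed
      qed
      show ?thesis
        unfolding main[OF ab] using int1[OF 1(2)] int2[of b] int2[of "- b"] parity_of_cubic_norm[OF 1(1)]
        by (auto split: if_splits)
    qed
    thus ?thesis unfolding root using uniq main by blast
  qed
  have case_b: "unique_up_to_sign (cubic_rep p (real q)) \<and>
       (\<forall>a b. cubic_rep p (real q) a b \<longrightarrow>
          (\<forall>s c d :: complex.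
             s ^ 2 = - 27 \<longrightarrow> c ^ 3 = of_nat q \<longrightarrow>
             d ^ 3 = (1 / 2) * (- of_int a + s * of_int b) \<longrightarrow>
             (let W = c * d;
                  \<omega> = exp (2 * of_real pi * \<i> / 3);
                  x = (\<lambda>j::nat. - (1 / 3) * (1 + \<omega> ^ j * W + of_nat q / (\<omega> ^ j * W)))
              in graph_spectrum \<Gamma> =
                   replicate_mset 1 (of_nat n)
                   + replicate_mset n (x 0) + replicate_mset n (x 1)
                   + replicate_mset n (x 2))))"
    if p1: "[p = 1] (mod 3)"
  proof (intro conjI allI impI)
    show "unique_up_to_sign (cubic_rep p (real q))"
      unfolding q by (rule cubic_rep_unique_up_to_sign[OF p p1 m])
  next
    fix a b and s c d :: complex
    assume ab: "cubic_rep p (real q) a b" and s: "s ^ 2 = - 27" and c: "c ^ 3 = of_nat q"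
      and d: "d ^ 3 = (1 / 2) * (- of_int a + s * of_int b)"
    have "cubic_rep p (real (p ^ m)) A B" using AB p1 by (simp only: cubic_rep_int_iff)
    hence A: "A = a" using cubic_rep_unique[OF p p1 m] ab unfolding q by blast
    define w where "w = exp (2 * of_real pi * \<i> / 3 :: complex)"
    have w: "w ^ 3 = 1" "1 + w + w ^ 2 = 0" unfolding w_def by (rule exp_third_root_of_unity)+
    define Q where "Q = (of_nat q :: complex)"
    have Q0: "Q \<noteq> 0" using q5 by (simp add: Q_def)
    define W where "W = c * d"
    \<comment> \<open>\<open>d'\<close> is \<open>d\<^sup>3\<close> with \<open>s\<close> replaced by \<open>- s\<close>; the product of the two is \<open>q\<close>.\<close>
    define d' where "d' = (1 / 2) * (- of_int a - s * of_int b)"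
    have "4 * int q = a ^ 2 + 27 * b ^ 2" using ab by (simp add: cubic_rep_int_iff)
    hence "of_int (4 * int q) = (of_int (a ^ 2 + 27 * b ^ 2) :: complex)" by (simp only:)
    hence norm: "4 * Q = of_int a ^ 2 + 27 * of_int b ^ 2" by (simp add: Q_def)
    have "d ^ 3 * d' = (of_int a ^ 2 - s ^ 2 * of_int b ^ 2) / 4"
      unfolding d d'_def by (simp add: field_simps power2_eq_square)
    also have "\<dots> = (of_int a ^ 2 + 27 * of_int b ^ 2) / 4" unfolding s by simp
    also have "\<dots> = Q" unfolding norm[symmetric] by simp
    finally have dd: "d ^ 3 * d' = Q" .
    have d0: "d \<noteq> 0" using dd Q0 by auto
    have c0: "c \<noteq> 0" using c Q0 by (auto simp: Q_def)
    have W0: "W \<noteq> 0" using c0 d0 by (simp add: W_def)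
    have W3: "W ^ 3 = Q * d ^ 3" by (simp add: W_def power_mult_distrib c Q_def)
    define V where "V = Q / W"
    have UV: "W * V = Q" using W0 by (simp add: V_def)
    have "W ^ 3 * V ^ 3 = Q ^ 3" using UV by (simp flip: power_mult_distrib)
    also have "\<dots> = W ^ 3 * (Q * d')" unfolding W3 dd[symmetric] by (simp add: power3_eq_cube)
    finally have V3: "V ^ 3 = Q * d'" using W0 by simp
    define y where "y j = - (w ^ j * W + w ^ (2 * j) * V)" for j :: nat
    have sums: "y 0 + y 1 + y 2 = 0" "y 0 * y 1 + y 1 * y 2 + y 2 * y 0 = - 3 * (W * V)"
      "y 0 * y 1 * y 2 = - (W ^ 3 + V ^ 3)"
      unfolding y_def by (rule sum_conjugate_cubic_roots[OF w(2,1)])+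
    have prod: "y 0 * y 1 * y 2 = of_nat q * of_int A"
      unfolding sums(3) W3 V3 d d'_def A by (simp add: Q_def field_simps)
    have w0: "w \<noteq> 0" by (simp add: w_def)
    have V_eq: "of_nat q / (w ^ j * W) = w ^ (2 * j) * V" for j
    proof -
      have "w ^ j * w ^ (2 * j) = (w ^ 3) ^ j" by (simp flip: power_mult power_add)
      thus ?thesis using w0 W0 w(1) by (simp add: V_def Q_def field_simps)
    qed
    have "- (1 / 3) * (1 + w ^ j * W + of_nat q / (w ^ j * W)) = (y j - 1) / 3" for j
      unfolding V_eq y_def by (simp add: field_simps)
    thus "let W = c * d;
                  \<omega> = exp (2 * of_real pi * \<i> / 3);
                  x = (\<lambda>j::nat. - (1 / 3) * (1 + \<omega> ^ j * W + of_nat q / (\<omega> ^ j * W)))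
              in graph_spectrum \<Gamma> =
                   replicate_mset 1 (of_nat n)
                   + replicate_mset n (x 0) + replicate_mset n (x 1)
                   + replicate_mset n (x 2)"
      unfolding Let_def W_def[symmetric] w_def[symmetric]
      using spec[OF sums(1) _ prod] sums(2) UV by (simp only: Q_def)
  qed
  have case_c: "([m = 0] (mod 4) \<longrightarrow>
          graph_spectrum \<Gamma> =
            replicate_mset 1 (of_nat n)
            + replicate_mset (2 * n) (of_real ((sqrt (real q) - 1) / 3))
            + replicate_mset n (of_real ((- 2 * sqrt (real q) - 1) / 3))) \<and>
       ([m = 2] (mod 4) \<longrightarrow>
          graph_spectrum \<Gamma> =
            replicate_mset 1 (of_nat n)
            + replicate_mset n (of_real ((2 * sqrt (real q) - 1) / 3))
            + replicate_mset (2 * n) (of_real ((- sqrt (real q) - 1) / 3))) \<and>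
       set_mset (graph_spectrum \<Gamma>) \<subseteq> \<int>"
    if p2: "[p = 2] (mod 3)" and "even m"
  proof -
    obtain k where mk: "m = 2 * k" using \<open>even m\<close> by blast
    define r where "r = p ^ k"
    have qr: "p ^ m = r ^ 2" by (simp add: mk r_def mult.commute flip: power_mult)
    have sqrt: "sqrt (real q) = real r" by (simp add: q qr)
    \<comment> \<open>As \<open>p\<close> is inert, \<open>A = \<plusminus> 2 r\<close>, and the sign is decided modulo 3.\<close>
    have "B = 0" using cubic_norm_inert_power[OF p p2] AB(1) unfolding mk by blast
    hence "A ^ 2 = (2 * int r) ^ 2" using AB(1) qr by (simp add: power_mult_distrib)
    hence A: "A = 2 * int r \<or> A = - 2 * int r" unfolding power2_eq_iff by simp
    have rep2: "replicate_mset (2 * n) x = replicate_mset n x + replicate_mset n x" for x :: complex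
      by (rule multiset_eqI) simp
    have even_case: "[int r = 1] (mod 3) \<and> graph_spectrum \<Gamma> =
            replicate_mset 1 (of_nat n)
            + replicate_mset (2 * n) (of_real ((real r - 1) / 3))
            + replicate_mset n (of_real ((- 2 * real r - 1) / 3))" if "even k"
    proof -
      have "[r = 1] (mod 3)" unfolding r_def using power_eq_1_mod_3_cong(1)[OF p2 that] .
      hence r1: "[int r = 1] (mod 3)" by (metis cong_int_iff of_nat_1 of_nat_numeral)
      have "A \<noteq> 2 * int r"
        using AB(2) not_cong_1_mod_3_uminus[OF r1] double_cong_1_mod_3_iff by metis
      hence "A = - 2 * int r" using A by blast
      hence "graph_spectrum \<Gamma> = replicate_mset 1 (of_nat n)
         + replicate_mset n ((of_nat r - 1) / 3) + replicate_mset n ((of_nat r - 1) / 3)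
         + replicate_mset n ((- 2 * of_nat r - 1) / 3)"
        by (intro spec) (simp_all add: q qr power2_eq_square)
      thus ?thesis using r1 by (simp add: rep2 add.assoc)
    qed
    have odd_case: "[int r = 2] (mod 3) \<and> graph_spectrum \<Gamma> =
            replicate_mset 1 (of_nat n)
            + replicate_mset n (of_real ((2 * real r - 1) / 3))
            + replicate_mset (2 * n) (of_real ((- real r - 1) / 3))" if "odd k"
    proof -
      have "[r = 2] (mod 3)" unfolding r_def using power_eq_1_mod_3_cong(2)[OF p2 that] .
      hence r2: "[int r = 2] (mod 3)" by (metis cong_int_iff of_nat_numeral)
      have "A \<noteq> - 2 * int r"
      proof
        assume "A = - 2 * int r"
        moreover have "[- 2 * int r = - 2 * 2] (mod 3)" using r2 by (rule cong_scalar_left)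
        ultimately have "[1 = - 4 :: int] (mod 3)" using AB(2) cong_trans[OF cong_sym[OF AB(2)]] by simp
        thus False by (simp add: cong_def)
      qed
      hence "A = 2 * int r" using A by blast
      hence "graph_spectrum \<Gamma> = replicate_mset 1 (of_nat n)
         + replicate_mset n ((2 * of_nat r - 1) / 3) + replicate_mset n ((- of_nat r - 1) / 3)
         + replicate_mset n ((- of_nat r - 1) / 3)"
        by (intro spec) (simp_all add: q qr power2_eq_square)
      thus ?thesis using r2 by (simp add: rep2 add.assoc)
    qed
    have "set_mset (graph_spectrum \<Gamma>) \<subseteq> \<int>"
    proof (cases "even k")
      case True
      have "[int r = 1] (mod 3)" using even_case True by blast
      hence "[- 2 * int r = 1] (mod 3)" using double_cong_1_mod_3_iff[of "- int r"] by simp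
      from minus_1_div_3_in_Ints[OF this] minus_1_div_3_in_Ints[OF \<open>[int r = 1] (mod 3)\<close>]
      show ?thesis using even_case[OF True] by (auto split: if_splits)
    next
      case False
      have "[int r = 2] (mod 3)" using odd_case False by blast
      then obtain e where e: "int r - 2 = 3 * e" by (auto simp: cong_iff_dvd_diff)
      have "2 * int r - 1 = 3 * (2 * e + 1)" "- int r - 1 = 3 * (- e - 1)" using e by simp_all
      hence "[2 * int r = 1] (mod 3)" "[- int r = 1] (mod 3)" by (simp_all only: cong_iff_dvd_diff dvd_triv_left)
      from this[THEN minus_1_div_3_in_Ints]
      show ?thesis using odd_case[OF False] by (auto split: if_splits)
    qed
    moreover have "even k" if "[m = 0] (mod 4)" using that unfolding mk cong_def by presburger
    moreover have "odd k" if "[m = 2] (mod 4)" using that unfolding mk cong_def by presburger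
    ultimately show ?thesis unfolding sqrt using even_case odd_case by blast
  qed
  have conn: "Digraph_Component.connected (with_proj \<Gamma>)" and sym: "symmetric (with_proj \<Gamma>)"
    unfolding G using connected_gen_paley_3[OF n(2)] symmetric_gen_paley_3 .
  show ?thesis
  proof (rule conjI[OF conn conjI[OF sym conjI[OF real conjI[OF impI conjI[OF impI impI]]]]], goal_cases)
    case 1
    show ?case using case_a[OF conjunct1[OF 1] conjunct2[OF 1]] .
  next
    case 2
    show ?case using case_b[OF conjunct1[OF 2]] .
  next
    case 3
    show ?case using case_c[OF conjunct1[OF 3] conjunct2[OF 3]] .
  qed
qed

end
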